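(* Let $\Phi$ be a field of characteristic zero or characteristic at least $5$, and let $L=L_1\oplus L_0\oplus L_{-1}$ be a Jordan 3-graded Lie algebra over $\Phi$ with associated Jordan pair $V=(L_1,L_{-1})$. Then $K(L)=\widetilde{\mathcal{I}(Mc(V))}$, where $K(L)$ is the Kostrikin radical of $L$, $Mc(V)$ is the McCrimmon radical of $V$, $\mathcal{I}(Mc(V))$ is the ideal of $L$ generated by $Mc(V)$, and $\widetilde{I}=\{x\in L\mid [x,L]\subseteq I\}$ for an ideal $I$ of $L$.
   Context: A Lie algebra $L$ is 3-graded if $L=L_1\oplus L_0\oplus L_{-1}$ with $[L_i,L_j]\subseteq L_{i+j}$, where $L_k=0$ for $k\notin\{0,\pm1\}$. It is Jordan 3-graded if moreover $[L_1,L_{-1}]=L_0$ and $(L_1,L_{-1})$ is a Jordan pair with $\{x,y,z\}=[[x,y],z]$, $Q_xy=\frac12[[x,y],x]$; this is the associated Jordan pair $V=(V^+,V^-)=(L_1,L_{-1})$. A Lie algebra is nondegenerate if $(\mathrm{ad}\,z)^2=0$ implies $z=0$. The Kostrikin radical $K(L)$ is the smallest ideal of $L$ such that $L/K(L)$ is nondegenerate. A Jordan pair $V$ is nondegenerate if $Q_z=0$ implies $z=0$, for $z\in V^\sigma$, $\sigma=\pm$. The McCrimmon radical $Mc(V)$ is the smallest ideal of $V$ such that $V/Mc(V)$ is nondegenerate. For an ideal $U=(U^+,U^-)$ of $V$, $\mathcal{I}(U)=U^+\oplus([U^+,V^-]+[V^+,U^-])\oplus U^-$, an ideal of $L$. 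*)

theory Defs
  imports Complex_Main "HOL-Algebra.AbelCoset" "HOL-Algebra.Module"
begin

definition ring_char :: "('k, 'r) ring_scheme \<Rightarrow> nat" where
  "ring_char R =
     (if \<exists>n::nat. n > 0 \<and> [n] \<cdot>\<^bsub>R\<^esub> \<one>\<^bsub>R\<^esub> = \<zero>\<^bsub>R\<^esub>
      then LEAST n::nat. n > 0 \<and> [n] \<cdot>\<^bsub>R\<^esub> \<one>\<^bsub>R\<^esub> = \<zero>\<^bsub>R\<^esub>
      else 0)"

section \<open>Lie algebras\<close>

text \<open>The fields \<open>mult\<close> and \<open>one\<close>, inherited through the record \<open>module\<close> from \<open>ring\<close>,
  play no role (as in any use of that record for a bare module).\<close>

record ('k, 'a) lie_alg = "('k, 'a) module" +
  bracket :: "'a \<Rightarrow> 'a \<Rightarrow> 'a" (\<open>\<lblot>_,/ _\<rblot>\<index>\<close>)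

locale lie_algebra = module R L for R :: "('k, 'r) ring_scheme" (structure)
    and L :: "('k, 'a, 'l) lie_alg_scheme" (structure) +
  assumes bracket_closed [simp, intro]:
      "\<lbrakk>x \<in> carrier L; y \<in> carrier L\<rbrakk> \<Longrightarrow> \<lblot>x, y\<rblot>\<^bsub>L\<^esub> \<in> carrier L"
    and bracket_add_left:
      "\<lbrakk>x \<in> carrier L; y \<in> carrier L; z \<in> carrier L\<rbrakk> \<Longrightarrow>
        \<lblot>x \<oplus>\<^bsub>L\<^esub> y, z\<rblot>\<^bsub>L\<^esub> = \<lblot>x, z\<rblot>\<^bsub>L\<^esub> \<oplus>\<^bsub>L\<^esub> \<lblot>y, z\<rblot>\<^bsub>L\<^esub>"
    and bracket_add_right:
      "\<lbrakk>x \<in> carrier L; y \<in> carrier L; z \<in> carrier L\<rbrakk> \<Longrightarrow>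
        \<lblot>x, y \<oplus>\<^bsub>L\<^esub> z\<rblot>\<^bsub>L\<^esub> = \<lblot>x, y\<rblot>\<^bsub>L\<^esub> \<oplus>\<^bsub>L\<^esub> \<lblot>x, z\<rblot>\<^bsub>L\<^esub>"
    and bracket_smult_left:
      "\<lbrakk>a \<in> carrier R; x \<in> carrier L; y \<in> carrier L\<rbrakk> \<Longrightarrow>
        \<lblot>a \<odot>\<^bsub>L\<^esub> x, y\<rblot>\<^bsub>L\<^esub> = a \<odot>\<^bsub>L\<^esub> \<lblot>x, y\<rblot>\<^bsub>L\<^esub>"
    and bracket_smult_right:
      "\<lbrakk>a \<in> carrier R; x \<in> carrier L; y \<in> carrier L\<rbrakk> \<Longrightarrow>
        \<lblot>x, a \<odot>\<^bsub>L\<^esub> y\<rblot>\<^bsub>L\<^esub> = a \<odot>\<^bsub>L\<^esub> \<lblot>x, y\<rblot>\<^bsub>L\<^esub>"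
    and bracket_self [simp]:
      "x \<in> carrier L \<Longrightarrow> \<lblot>x, x\<rblot>\<^bsub>L\<^esub> = \<zero>\<^bsub>L\<^esub>"
    and jacobi:
      "\<lbrakk>x \<in> carrier L; y \<in> carrier L; z \<in> carrier L\<rbrakk> \<Longrightarrow>
        \<lblot>x, \<lblot>y, z\<rblot>\<^bsub>L\<^esub>\<rblot>\<^bsub>L\<^esub> \<oplus>\<^bsub>L\<^esub> \<lblot>y, \<lblot>z, x\<rblot>\<^bsub>L\<^esub>\<rblot>\<^bsub>L\<^esub> \<oplus>\<^bsub>L\<^esub> \<lblot>z, \<lblot>x, y\<rblot>\<^bsub>L\<^esub>\<rblot>\<^bsub>L\<^esub> = \<zero>\<^bsub>L\<^esub>"

definition lie_ideal :: "('k, 'r) ring_scheme \<Rightarrow> ('k, 'a, 'l) lie_alg_scheme \<Rightarrow> 'a set \<Rightarrow> bool" where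
  "lie_ideal R L I \<longleftrightarrow>
     submodule I R L \<and> (\<forall>x\<in>I. \<forall>y\<in>carrier L. \<lblot>x, y\<rblot>\<^bsub>L\<^esub> \<in> I)"

definition lie_quotient :: "('k, 'a, 'l) lie_alg_scheme \<Rightarrow> 'a set \<Rightarrow> ('k, 'a set) lie_alg" where
  "lie_quotient L I =
     \<lparr>carrier = a_rcosets\<^bsub>L\<^esub> I, mult = undefined, one = undefined, zero = I, add = set_add L,
      smult = (\<lambda>a X. \<Union>x\<in>X. I +>\<^bsub>L\<^esub> (a \<odot>\<^bsub>L\<^esub> x)),
      bracket = (\<lambda>X Y. \<Union>x\<in>X. \<Union>y\<in>Y. I +>\<^bsub>L\<^esub> \<lblot>x, y\<rblot>\<^bsub>L\<^esub>)\<rparr>"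

definition lie_nondegenerate :: "('k, 'a, 'l) lie_alg_scheme \<Rightarrow> bool" where
  "lie_nondegenerate L \<longleftrightarrow>
     (\<forall>z\<in>carrier L. (\<forall>x\<in>carrier L. \<lblot>z, \<lblot>z, x\<rblot>\<^bsub>L\<^esub>\<rblot>\<^bsub>L\<^esub> = \<zero>\<^bsub>L\<^esub>) \<longrightarrow> z = \<zero>\<^bsub>L\<^esub>)"

definition kostrikin_radical :: "('k, 'r) ring_scheme \<Rightarrow> ('k, 'a, 'l) lie_alg_scheme \<Rightarrow> 'a set" where
  "kostrikin_radical R L = (LEAST K. lie_ideal R L K \<and> lie_nondegenerate (lie_quotient L K))"

definition lie_tilde :: "('k, 'a, 'l) lie_alg_scheme \<Rightarrow> 'a set \<Rightarrow> 'a set" where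
  "lie_tilde L I = {x \<in> carrier L. \<forall>y\<in>carrier L. \<lblot>x, y\<rblot>\<^bsub>L\<^esub> \<in> I}"

text \<open>\<open>[A, B]\<close> for sets of vectors: the linear span of all brackets.\<close>

definition bracket_span ::
  "('k, 'r) ring_scheme \<Rightarrow> ('k, 'a, 'l) lie_alg_scheme \<Rightarrow> 'a set \<Rightarrow> 'a set \<Rightarrow> 'a set" where
  "bracket_span R L A B = (\<lambda>H. submodule H R L) hull {\<lblot>x, y\<rblot>\<^bsub>L\<^esub> | x y. x \<in> A \<and> y \<in> B}"

section \<open>Jordan pairs\<close>

datatype pair_sign = Pos | Neg

fun opp :: "pair_sign \<Rightarrow> pair_sign" where
  "opp Pos = Neg"
| "opp Neg = Pos"

fun sign_int :: "pair_sign \<Rightarrow> int" where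
  "sign_int Pos = 1"
| "sign_int Neg = -1"

text \<open>\<open>jpQ V s x y\<close> is \<open>Q\<^sub>x y\<close> for \<open>x\<close> in the component \<open>s\<close> and \<open>y\<close> in the component \<open>opp s\<close>.\<close>

record ('k, 'a) jpair =
  jpV :: "pair_sign \<Rightarrow> ('k, 'a) module"
  jpQ :: "pair_sign \<Rightarrow> 'a \<Rightarrow> 'a \<Rightarrow> 'a"

text \<open>\<open>{x, y, z}\<close> is the polarization of \<open>Q\<^sub>x y\<close> in \<open>x\<close>.\<close>

definition jp_triple :: "('k, 'a) jpair \<Rightarrow> pair_sign \<Rightarrow> 'a \<Rightarrow> 'a \<Rightarrow> 'a \<Rightarrow> 'a" where
  "jp_triple V s x y z =
     jpQ V s (x \<oplus>\<^bsub>jpV V s\<^esub> z) y \<ominus>\<^bsub>jpV V s\<^esub> jpQ V s x y \<ominus>\<^bsub>jpV V s\<^esub> jpQ V s z y"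

text \<open>Loos' axioms: a pair of modules with quadratic maps \<open>Q\<close> satisfying (JP1)--(JP3).
  Loos requires the three identities in every scalar extension.  They are homogeneous of degree
  at most 4 in each variable, so over a field with at least 5 elements (in particular in
  characteristic 0 or at least 5) this follows from the identities over the field itself,
  which are the only ones required here.\<close>

locale jordan_pair =
  fixes R :: "('k, 'r) ring_scheme" and V :: "('k, 'a) jpair"
  assumes jp_module: "module R (jpV V s)"
    and jpQ_closed:
      "\<lbrakk>x \<in> carrier (jpV V s); y \<in> carrier (jpV V (opp s))\<rbrakk> \<Longrightarrow>
        jpQ V s x y \<in> carrier (jpV V s)"
    and jpQ_add_right:
      "\<lbrakk>x \<in> carrier (jpV V s); y \<in> carrier (jpV V (opp s)); y' \<in> carrier (jpV V (opp s))\<rbrakk> \<Longrightarrow>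
        jpQ V s x (y \<oplus>\<^bsub>jpV V (opp s)\<^esub> y') = jpQ V s x y \<oplus>\<^bsub>jpV V s\<^esub> jpQ V s x y'"
    and jpQ_smult_right:
      "\<lbrakk>a \<in> carrier R; x \<in> carrier (jpV V s); y \<in> carrier (jpV V (opp s))\<rbrakk> \<Longrightarrow>
        jpQ V s x (a \<odot>\<^bsub>jpV V (opp s)\<^esub> y) = a \<odot>\<^bsub>jpV V s\<^esub> jpQ V s x y"
    and jpQ_smult_left:
      "\<lbrakk>a \<in> carrier R; x \<in> carrier (jpV V s); y \<in> carrier (jpV V (opp s))\<rbrakk> \<Longrightarrow>
        jpQ V s (a \<odot>\<^bsub>jpV V s\<^esub> x) y = (a \<otimes>\<^bsub>R\<^esub> a) \<odot>\<^bsub>jpV V s\<^esub> jpQ V s x y"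
    and jp_triple_add_left:
      "\<lbrakk>x \<in> carrier (jpV V s); x' \<in> carrier (jpV V s); y \<in> carrier (jpV V (opp s));
        z \<in> carrier (jpV V s)\<rbrakk> \<Longrightarrow>
        jp_triple V s (x \<oplus>\<^bsub>jpV V s\<^esub> x') y z =
          jp_triple V s x y z \<oplus>\<^bsub>jpV V s\<^esub> jp_triple V s x' y z"
    and jp_triple_smult_left:
      "\<lbrakk>a \<in> carrier R; x \<in> carrier (jpV V s); y \<in> carrier (jpV V (opp s));
        z \<in> carrier (jpV V s)\<rbrakk> \<Longrightarrow>
        jp_triple V s (a \<odot>\<^bsub>jpV V s\<^esub> x) y z = a \<odot>\<^bsub>jpV V s\<^esub> jp_triple V s x y z"
    and JP1:
      "\<lbrakk>x \<in> carrier (jpV V s); y \<in> carrier (jpV V (opp s)); z \<in> carrier (jpV V (opp s))\<rbrakk> \<Longrightarrow>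
        jp_triple V s x y (jpQ V s x z) = jpQ V s x (jp_triple V (opp s) y x z)"
    and JP2:
      "\<lbrakk>x \<in> carrier (jpV V s); y \<in> carrier (jpV V (opp s)); z \<in> carrier (jpV V s)\<rbrakk> \<Longrightarrow>
        jp_triple V s (jpQ V s x y) y z = jp_triple V s x (jpQ V (opp s) y x) z"
    and JP3:
      "\<lbrakk>x \<in> carrier (jpV V s); y \<in> carrier (jpV V (opp s)); z \<in> carrier (jpV V (opp s))\<rbrakk> \<Longrightarrow>
        jpQ V s (jpQ V s x y) z = jpQ V s x (jpQ V (opp s) y (jpQ V s x z))"

definition jp_ideal ::
  "('k, 'r) ring_scheme \<Rightarrow> ('k, 'a) jpair \<Rightarrow> (pair_sign \<Rightarrow> 'a set) \<Rightarrow> bool" where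
  "jp_ideal R V U \<longleftrightarrow> (\<forall>s.
     submodule (U s) R (jpV V s) \<and>
     (\<forall>u\<in>U s. \<forall>y\<in>carrier (jpV V (opp s)). jpQ V s u y \<in> U s) \<and>
     (\<forall>x\<in>carrier (jpV V s). \<forall>u\<in>U (opp s). jpQ V s x u \<in> U s) \<and>
     (\<forall>x\<in>carrier (jpV V s). \<forall>y\<in>carrier (jpV V (opp s)). \<forall>u\<in>U s. jp_triple V s x y u \<in> U s))"

definition jp_quotient :: "('k, 'a) jpair \<Rightarrow> (pair_sign \<Rightarrow> 'a set) \<Rightarrow> ('k, 'a set) jpair" where
  "jp_quotient V U =
     \<lparr>jpV = (\<lambda>s.
        \<lparr>carrier = a_rcosets\<^bsub>jpV V s\<^esub> (U s), mult = undefined, one = undefined,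
         zero = U s, add = set_add (jpV V s),
         smult = (\<lambda>a X. \<Union>x\<in>X. U s +>\<^bsub>jpV V s\<^esub> (a \<odot>\<^bsub>jpV V s\<^esub> x))\<rparr>),
      jpQ = (\<lambda>s X Y. \<Union>x\<in>X. \<Union>y\<in>Y. U s +>\<^bsub>jpV V s\<^esub> jpQ V s x y)\<rparr>"

definition jp_nondegenerate :: "('k, 'a) jpair \<Rightarrow> bool" where
  "jp_nondegenerate V \<longleftrightarrow>
     (\<forall>s. \<forall>z\<in>carrier (jpV V s).
        (\<forall>y\<in>carrier (jpV V (opp s)). jpQ V s z y = \<zero>\<^bsub>jpV V s\<^esub>) \<longrightarrow> z = \<zero>\<^bsub>jpV V s\<^esub>)"

text \<open>The order on functions \<open>pair_sign \<Rightarrow> 'a set\<close> is componentwise inclusion.\<close>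

definition mccrimmon_radical ::
  "('k, 'r) ring_scheme \<Rightarrow> ('k, 'a) jpair \<Rightarrow> pair_sign \<Rightarrow> 'a set" where
  "mccrimmon_radical R V = (LEAST U. jp_ideal R V U \<and> jp_nondegenerate (jp_quotient V U))"

section \<open>Jordan 3-graded Lie algebras\<close>

locale three_graded_lie_algebra = lie_algebra R L
  for R :: "('k, 'r) ring_scheme" (structure)
    and L :: "('k, 'a, 'l) lie_alg_scheme" (structure) +
  fixes G :: "int \<Rightarrow> 'a set"
  assumes G_submodule: "submodule (G i) R L"
    and G_zero: "i \<notin> {1, 0, -1} \<Longrightarrow> G i = {\<zero>\<^bsub>L\<^esub>}"
    and G_direct_sum:
      "x \<in> carrier L \<Longrightarrow>
        \<exists>!(a, b, c). a \<in> G 1 \<and> b \<in> G 0 \<and> c \<in> G (-1) \<and> x = a \<oplus>\<^bsub>L\<^esub> b \<oplus>\<^bsub>L\<^esub> c"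
    and G_bracket: "\<lbrakk>x \<in> G i; y \<in> G j\<rbrakk> \<Longrightarrow> \<lblot>x, y\<rblot>\<^bsub>L\<^esub> \<in> G (i + j)"

definition associated_jpair ::
  "('k, 'r) ring_scheme \<Rightarrow> ('k, 'a, 'l) lie_alg_scheme \<Rightarrow> (int \<Rightarrow> 'a set) \<Rightarrow> ('k, 'a) jpair" where
  "associated_jpair R L G =
     \<lparr>jpV = (\<lambda>s.
        \<lparr>carrier = G (sign_int s), mult = undefined, one = undefined,
         zero = \<zero>\<^bsub>L\<^esub>, add = add L, smult = smult L\<rparr>),
      jpQ = (\<lambda>s x y. inv\<^bsub>R\<^esub> (\<one>\<^bsub>R\<^esub> \<oplus>\<^bsub>R\<^esub> \<one>\<^bsub>R\<^esub>) \<odot>\<^bsub>L\<^esub> \<lblot>\<lblot>x, y\<rblot>\<^bsub>L\<^esub>, x\<rblot>\<^bsub>L\<^esub>)\<rparr>"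

locale jordan_3graded_lie_algebra = three_graded_lie_algebra R L G
  for R :: "('k, 'r) ring_scheme" (structure)
    and L :: "('k, 'a, 'l) lie_alg_scheme" (structure)
    and G :: "int \<Rightarrow> 'a set" +
  assumes G_bracket_span: "bracket_span R L (G 1) (G (-1)) = G 0"
    and jordan_pair: "jordan_pair R (associated_jpair R L G)"
    and triple_product:
      "\<lbrakk>x \<in> G (sign_int s); y \<in> G (sign_int (opp s)); z \<in> G (sign_int s)\<rbrakk> \<Longrightarrow>
        jp_triple (associated_jpair R L G) s x y z = \<lblot>\<lblot>x, y\<rblot>\<^bsub>L\<^esub>, z\<rblot>\<^bsub>L\<^esub>"

text \<open>\<open>\<I>(U)\<close> for an ideal \<open>U\<close> of the associated Jordan pair \<open>V = (G 1, G (-1))\<close>.\<close>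

definition pair_ideal_to_lie ::
  "('k, 'r) ring_scheme \<Rightarrow> ('k, 'a, 'l) lie_alg_scheme \<Rightarrow> (int \<Rightarrow> 'a set) \<Rightarrow>
    (pair_sign \<Rightarrow> 'a set) \<Rightarrow> 'a set" where
  "pair_ideal_to_lie R L G U =
     U Pos <+>\<^bsub>L\<^esub>
     (bracket_span R L (U Pos) (G (-1)) <+>\<^bsub>L\<^esub> bracket_span R L (G 1) (U Neg)) <+>\<^bsub>L\<^esub>
     U Neg"

section \<open>The two radicals exist\<close>

lemma (in module) submodule_iff:
  "submodule H R M \<longleftrightarrow> H \<subseteq> carrier M \<and> \<zero>\<^bsub>M\<^esub> \<in> H \<and>
     (\<forall>x\<in>H. \<forall>y\<in>H. x \<oplus>\<^bsub>M\<^esub> y \<in> H) \<and> (\<forall>a\<in>carrier R. \<forall>x\<in>H. a \<odot>\<^bsub>M\<^esub> x \<in> H)"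
  (is "?l \<longleftrightarrow> ?r")
proof
  assume ?l
  then interpret submodule H R M .
  show ?r
    using subset one_closed m_closed by auto
next
  assume r: ?r
  have inv: "\<ominus>\<^bsub>M\<^esub> x \<in> H" if "x \<in> H" for x
  proof -
    have x: "x \<in> carrier M" using r that by auto
    have "(\<ominus> \<one>) \<odot>\<^bsub>M\<^esub> x = \<ominus>\<^bsub>M\<^esub> x"
      using smult_l_minus[OF R.one_closed x] x by simp
    then show ?thesis using r that by (metis R.a_inv_closed R.one_closed)
  qed
  show ?l
    by (rule submoduleI) (use r inv in auto)
qed

lemma (in module) submodule_Inter:
  assumes "\<S> \<noteq> {}" "\<And>H. H \<in> \<S> \<Longrightarrow> submodule H R M"
  shows "submodule (\<Inter>\<S>) R M"
  using assms unfolding submodule_iff by blast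

lemma (in module) submodule_abelian_subgroup:
  assumes "submodule H R M"
  shows "abelian_subgroup H M"
  using assms
  by (intro abelian_subgroupI3 additive_subgroup.intro M.abelian_group_axioms)
     (auto simp: submodule_def)

lemma (in module) coset_eq_sub_iff:
  assumes "submodule H R M" "x \<in> carrier M"
  shows "H +>\<^bsub>M\<^esub> x = H \<longleftrightarrow> x \<in> H"
proof -
  interpret abelian_subgroup H M by (rule submodule_abelian_subgroup[OF assms(1)])
  show ?thesis
    using a_rcos_self[OF assms(2)] a_rcos_const[of x] by auto
qed

lemma (in module) coset_elem:
  assumes "submodule H R M" "x \<in> carrier M" "x' \<in> H +>\<^bsub>M\<^esub> x"
  obtains h where "h \<in> H" "h \<in> carrier M" "x' = h \<oplus>\<^bsub>M\<^esub> x"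
  using assms submoduleE(1)[OF assms(1)] unfolding a_r_coset_def' by auto

lemma (in module) self_in_coset:
  assumes "submodule H R M" "x \<in> carrier M"
  shows "x \<in> H +>\<^bsub>M\<^esub> x"
  by (rule abelian_subgroup.a_rcos_self[OF submodule_abelian_subgroup]) fact+

lemma (in module) coset_add_absorb:
  assumes "submodule H R M" "x \<in> carrier M" "h \<in> H"
  shows "H +>\<^bsub>M\<^esub> (h \<oplus>\<^bsub>M\<^esub> x) = H +>\<^bsub>M\<^esub> x"
proof -
  have "h \<oplus>\<^bsub>M\<^esub> x \<in> H +>\<^bsub>M\<^esub> x" using assms(3) unfolding a_r_coset_def' by auto
  then show ?thesis using M.a_repr_independence[OF _ assms(2) submodule.axioms(1)[OF assms(1)]] by simp
qed

lemma (in lie_algebra) lie_quotient_bracket: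
  assumes I: "lie_ideal R L I" and x: "x \<in> carrier L" and y: "y \<in> carrier L"
  shows "\<lblot>I +>\<^bsub>L\<^esub> x, I +>\<^bsub>L\<^esub> y\<rblot>\<^bsub>lie_quotient L I\<^esub> = I +>\<^bsub>L\<^esub> \<lblot>x, y\<rblot>\<^bsub>L\<^esub>"
proof -
  have S: "submodule I R L" using I by (simp add: lie_ideal_def)
  have sw: "\<lblot>u, v\<rblot>\<^bsub>L\<^esub> \<in> I" if "v \<in> I" "u \<in> carrier L" for u v
  proof -
    have v: "v \<in> carrier L" using that submoduleE(1)[OF S] by auto
    have "\<zero>\<^bsub>L\<^esub> = \<lblot>u \<oplus>\<^bsub>L\<^esub> v, u \<oplus>\<^bsub>L\<^esub> v\<rblot>\<^bsub>L\<^esub>" using v that by simp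
    also have "\<dots> = \<lblot>u, u \<oplus>\<^bsub>L\<^esub> v\<rblot>\<^bsub>L\<^esub> \<oplus>\<^bsub>L\<^esub> \<lblot>v, u \<oplus>\<^bsub>L\<^esub> v\<rblot>\<^bsub>L\<^esub>"
      using v that by (intro bracket_add_left) auto
    also have "\<dots> = \<lblot>u, v\<rblot>\<^bsub>L\<^esub> \<oplus>\<^bsub>L\<^esub> \<lblot>v, u\<rblot>\<^bsub>L\<^esub>"
      using v that by (simp add: bracket_add_right)
    finally have "\<lblot>u, v\<rblot>\<^bsub>L\<^esub> = \<ominus>\<^bsub>L\<^esub> \<lblot>v, u\<rblot>\<^bsub>L\<^esub>"
      using v that by (metis M.minus_equality bracket_closed)
    then show ?thesis using that I submoduleE(3)[OF S] by (simp add: lie_ideal_def)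
  qed
  have *: "I +>\<^bsub>L\<^esub> \<lblot>x', y'\<rblot>\<^bsub>L\<^esub> = I +>\<^bsub>L\<^esub> \<lblot>x, y\<rblot>\<^bsub>L\<^esub>"
    if x': "x' \<in> I +>\<^bsub>L\<^esub> x" and y': "y' \<in> I +>\<^bsub>L\<^esub> y" for x' y'
  proof -
    obtain h where h: "h \<in> I" "h \<in> carrier L" "x' = h \<oplus>\<^bsub>L\<^esub> x" using coset_elem[OF S x x'] .
    obtain k where k: "k \<in> I" "k \<in> carrier L" "y' = k \<oplus>\<^bsub>L\<^esub> y" using coset_elem[OF S y y'] .
    have "\<lblot>x', y'\<rblot>\<^bsub>L\<^esub> = \<lblot>h, k \<oplus>\<^bsub>L\<^esub> y\<rblot>\<^bsub>L\<^esub> \<oplus>\<^bsub>L\<^esub> \<lblot>x, k\<rblot>\<^bsub>L\<^esub> \<oplus>\<^bsub>L\<^esub> \<lblot>x, y\<rblot>\<^bsub>L\<^esub>"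
      using h k x y by (simp add: bracket_add_left bracket_add_right M.a_ac)
    moreover have "\<lblot>h, k \<oplus>\<^bsub>L\<^esub> y\<rblot>\<^bsub>L\<^esub> \<oplus>\<^bsub>L\<^esub> \<lblot>x, k\<rblot>\<^bsub>L\<^esub> \<in> I"
      using sw[of k x] I h k x y submoduleE(5)[OF S] by (simp add: lie_ideal_def)
    ultimately show ?thesis
      using coset_add_absorb[OF S bracket_closed[OF x y]] by simp
  qed
  have "\<lblot>I +>\<^bsub>L\<^esub> x, I +>\<^bsub>L\<^esub> y\<rblot>\<^bsub>lie_quotient L I\<^esub> =
      (\<Union>x'\<in>I +>\<^bsub>L\<^esub> x. \<Union>y'\<in>I +>\<^bsub>L\<^esub> y. I +>\<^bsub>L\<^esub> \<lblot>x', y'\<rblot>\<^bsub>L\<^esub>)"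
    by (simp add: lie_quotient_def)
  also have "\<dots> = (\<Union>x'\<in>I +>\<^bsub>L\<^esub> x. \<Union>y'\<in>I +>\<^bsub>L\<^esub> y. I +>\<^bsub>L\<^esub> \<lblot>x, y\<rblot>\<^bsub>L\<^esub>)"
    by (intro SUP_cong refl *)
  also have "\<dots> = I +>\<^bsub>L\<^esub> \<lblot>x, y\<rblot>\<^bsub>L\<^esub>"
    using self_in_coset[OF S x] self_in_coset[OF S y] by blast
  finally show ?thesis .
qed

lemma (in lie_algebra) lie_nondegenerate_quotient_iff:
  assumes I: "lie_ideal R L I"
  shows "lie_nondegenerate (lie_quotient L I) \<longleftrightarrow>
    (\<forall>z\<in>carrier L. (\<forall>x\<in>carrier L. \<lblot>z, \<lblot>z, x\<rblot>\<^bsub>L\<^esub>\<rblot>\<^bsub>L\<^esub> \<in> I) \<longrightarrow> z \<in> I)"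
proof -
  have S: "submodule I R L" using I by (simp add: lie_ideal_def)
  have c: "carrier (lie_quotient L I) = (\<lambda>x. I +>\<^bsub>L\<^esub> x) ` carrier L"
    by (auto simp: lie_quotient_def A_RCOSETS_def')
  have z: "\<zero>\<^bsub>lie_quotient L I\<^esub> = I" by (simp add: lie_quotient_def)
  show ?thesis
    unfolding lie_nondegenerate_def c z
    using I by (simp add: lie_quotient_bracket coset_eq_sub_iff[OF S])
qed

lemma (in lie_algebra) kostrikin_radical_is_least:
  shows kostrikin_radical_ideal: "lie_ideal R L (kostrikin_radical R L)"
    and kostrikin_radical_nondegenerate:
      "lie_nondegenerate (lie_quotient L (kostrikin_radical R L))"
    and kostrikin_radical_least:
      "\<lbrakk>lie_ideal R L I; lie_nondegenerate (lie_quotient L I)\<rbrakk> \<Longrightarrow> kostrikin_radical R L \<subseteq> I"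
proof -
  let ?P = "\<lambda>I. lie_ideal R L I \<and> lie_nondegenerate (lie_quotient L I)"
  let ?K = "\<Inter>{I. ?P I}"
  have car: "lie_ideal R L (carrier L)"
    using carrier_is_submodule by (simp add: lie_ideal_def)
  then have ne: "{I. ?P I} \<noteq> {}"
    using lie_nondegenerate_quotient_iff[OF car] by blast
  have id: "lie_ideal R L ?K"
    using submodule_Inter[OF ne] by (auto simp: lie_ideal_def)
  have "lie_nondegenerate (lie_quotient L ?K)"
    unfolding lie_nondegenerate_quotient_iff[OF id]
    using lie_nondegenerate_quotient_iff by blast
  with id have P: "?P ?K" by simp
  have eq: "kostrikin_radical R L = ?K"
    unfolding kostrikin_radical_def by (rule Least_equality) (use P in blast)+
  show "lie_ideal R L (kostrikin_radical R L)"
    and "lie_nondegenerate (lie_quotient L (kostrikin_radical R L))"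
    using P eq by simp_all
  show "kostrikin_radical R L \<subseteq> I"
    if "lie_ideal R L I" "lie_nondegenerate (lie_quotient L I)"
    using that eq by auto
qed

lemma opp_opp [simp]: "opp (opp s) = s"
  by (cases s) auto

lemma (in jordan_pair) jp_quotient_Q:
  assumes U: "jp_ideal R V U" and x: "x \<in> carrier (jpV V s)" and y: "y \<in> carrier (jpV V (opp s))"
  shows "jpQ (jp_quotient V U) s (U s +>\<^bsub>jpV V s\<^esub> x) (U (opp s) +>\<^bsub>jpV V (opp s)\<^esub> y) =
    U s +>\<^bsub>jpV V s\<^esub> jpQ V s x y"
proof -
  interpret A: module R "jpV V s" by (rule jp_module)
  interpret B: module R "jpV V (opp s)" by (rule jp_module)
  have S: "submodule (U s) R (jpV V s)" and S': "submodule (U (opp s)) R (jpV V (opp s))"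
    using U by (auto simp: jp_ideal_def)
  have *: "U s +>\<^bsub>jpV V s\<^esub> jpQ V s x' y' = U s +>\<^bsub>jpV V s\<^esub> jpQ V s x y"
    if x': "x' \<in> U s +>\<^bsub>jpV V s\<^esub> x" and y': "y' \<in> U (opp s) +>\<^bsub>jpV V (opp s)\<^esub> y" for x' y'
  proof -
    obtain h where h: "h \<in> U s" "h \<in> carrier (jpV V s)" "x' = h \<oplus>\<^bsub>jpV V s\<^esub> x"
      using A.coset_elem[OF S x x'] .
    obtain k where k: "k \<in> U (opp s)" "k \<in> carrier (jpV V (opp s))" "y' = k \<oplus>\<^bsub>jpV V (opp s)\<^esub> y"
      using B.coset_elem[OF S' y y'] .
    have xc: "x' \<in> carrier (jpV V s)" using h x by simp
    have q: "jpQ V s x' k \<in> U s" "jpQ V s h y \<in> U s" "jp_triple V s x y h \<in> U s"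
      using U h k x y xc by (auto simp: jp_ideal_def)
    have qc: "jpQ V s x' k \<in> carrier (jpV V s)" "jpQ V s h y \<in> carrier (jpV V s)"
      "jp_triple V s x y h \<in> carrier (jpV V s)" "jpQ V s x y \<in> carrier (jpV V s)"
      "jpQ V s x' y \<in> carrier (jpV V s)"
      using q A.submoduleE(1)[OF S] jpQ_closed[OF x y] jpQ_closed[OF xc y] by auto
    have "jp_triple V s x y h = jpQ V s x' y \<ominus>\<^bsub>jpV V s\<^esub> jpQ V s x y \<ominus>\<^bsub>jpV V s\<^esub> jpQ V s h y"
      using h x by (simp add: jp_triple_def A.M.a_comm)
    then have "jpQ V s x' y = (jp_triple V s x y h \<oplus>\<^bsub>jpV V s\<^esub> jpQ V s h y) \<oplus>\<^bsub>jpV V s\<^esub> jpQ V s x y"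
      using qc by (simp add: A.M.minus_eq A.M.a_assoc A.M.l_neg)
    moreover have "jpQ V s x' y' = jpQ V s x' k \<oplus>\<^bsub>jpV V s\<^esub> jpQ V s x' y"
      using jpQ_add_right[OF xc k(2) y] k by simp
    ultimately have "jpQ V s x' y' = (jpQ V s x' k \<oplus>\<^bsub>jpV V s\<^esub>
        (jp_triple V s x y h \<oplus>\<^bsub>jpV V s\<^esub> jpQ V s h y)) \<oplus>\<^bsub>jpV V s\<^esub> jpQ V s x y"
      using qc by (simp add: A.M.a_assoc)
    moreover have "jpQ V s x' k \<oplus>\<^bsub>jpV V s\<^esub>
        (jp_triple V s x y h \<oplus>\<^bsub>jpV V s\<^esub> jpQ V s h y) \<in> U s"
      using q A.submoduleE(5)[OF S] by simp
    ultimately show ?thesis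
      using A.coset_add_absorb[OF S qc(4)] by simp
  qed
  have "jpQ (jp_quotient V U) s (U s +>\<^bsub>jpV V s\<^esub> x) (U (opp s) +>\<^bsub>jpV V (opp s)\<^esub> y) =
      (\<Union>x'\<in>U s +>\<^bsub>jpV V s\<^esub> x. \<Union>y'\<in>U (opp s) +>\<^bsub>jpV V (opp s)\<^esub> y.
        U s +>\<^bsub>jpV V s\<^esub> jpQ V s x' y')"
    by (simp add: jp_quotient_def)
  also have "\<dots> = (\<Union>x'\<in>U s +>\<^bsub>jpV V s\<^esub> x. \<Union>y'\<in>U (opp s) +>\<^bsub>jpV V (opp s)\<^esub> y.
        U s +>\<^bsub>jpV V s\<^esub> jpQ V s x y)"
    by (intro SUP_cong refl *)
  also have "\<dots> = U s +>\<^bsub>jpV V s\<^esub> jpQ V s x y"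
    using A.self_in_coset[OF S x] B.self_in_coset[OF S' y] by blast
  finally show ?thesis .
qed

lemma (in jordan_pair) jp_nondegenerate_quotient_iff:
  assumes U: "jp_ideal R V U"
  shows "jp_nondegenerate (jp_quotient V U) \<longleftrightarrow>
    (\<forall>s. \<forall>z\<in>carrier (jpV V s). (\<forall>y\<in>carrier (jpV V (opp s)). jpQ V s z y \<in> U s) \<longrightarrow> z \<in> U s)"
proof -
  have S: "submodule (U s) R (jpV V s)" for s
    using U by (auto simp: jp_ideal_def)
  have c: "carrier (jpV (jp_quotient V U) s) =
      (\<lambda>x. U s +>\<^bsub>jpV V s\<^esub> x) ` carrier (jpV V s)" for s
    by (auto simp: jp_quotient_def A_RCOSETS_def')
  have z: "\<zero>\<^bsub>jpV (jp_quotient V U) s\<^esub> = U s" for s by (simp add: jp_quotient_def)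
  show ?thesis
    unfolding jp_nondegenerate_def c z
    by (simp add: jp_quotient_Q[OF U] module.coset_eq_sub_iff[OF jp_module S] jpQ_closed)
qed

lemma (in jordan_pair) mccrimmon_radical_is_least:
  shows mccrimmon_radical_ideal: "jp_ideal R V (mccrimmon_radical R V)"
    and mccrimmon_radical_nondegenerate:
      "jp_nondegenerate (jp_quotient V (mccrimmon_radical R V))"
    and mccrimmon_radical_least:
      "\<lbrakk>jp_ideal R V U; jp_nondegenerate (jp_quotient V U)\<rbrakk> \<Longrightarrow> mccrimmon_radical R V s \<subseteq> U s"
proof -
  let ?P = "\<lambda>U. jp_ideal R V U \<and> jp_nondegenerate (jp_quotient V U)"
  let ?K = "\<lambda>s. \<Inter>{U s | U. ?P U}"
  have tc: "jp_triple V s x y z \<in> carrier (jpV V s)"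
    if "x \<in> carrier (jpV V s)" "y \<in> carrier (jpV V (opp s))" "z \<in> carrier (jpV V s)" for s x y z
  proof -
    interpret module R "jpV V s" by (rule jp_module)
    show ?thesis using that by (simp add: jp_triple_def jpQ_closed)
  qed
  have car: "jp_ideal R V (\<lambda>s. carrier (jpV V s))"
    using module.carrier_is_submodule[OF jp_module] by (simp add: jp_ideal_def jpQ_closed tc)
  then have P0: "?P (\<lambda>s. carrier (jpV V s))"
    using jp_nondegenerate_quotient_iff[OF car] by blast
  have K_iff: "w \<in> ?K s \<longleftrightarrow> (\<forall>U. ?P U \<longrightarrow> w \<in> U s)" for w s
    by auto
  have sub: "submodule (?K s) R (jpV V s)" for s
    by (rule module.submodule_Inter[OF jp_module]) (use P0 in \<open>auto simp: jp_ideal_def\<close>)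
  have "jpQ V s u y \<in> ?K s" if u: "u \<in> ?K s" and "y \<in> carrier (jpV V (opp s))" for s u y
    unfolding K_iff using u[unfolded K_iff] that(2) by (simp add: jp_ideal_def)
  moreover have "jpQ V s x u \<in> ?K s" if "x \<in> carrier (jpV V s)" and u: "u \<in> ?K (opp s)" for s x u
    unfolding K_iff using u[unfolded K_iff] that(1) by (simp add: jp_ideal_def)
  moreover have "jp_triple V s x y u \<in> ?K s"
    if "x \<in> carrier (jpV V s)" "y \<in> carrier (jpV V (opp s))" and u: "u \<in> ?K s" for s x y u
    unfolding K_iff using u[unfolded K_iff] that(1,2) by (simp add: jp_ideal_def)
  ultimately have id: "jp_ideal R V ?K"
    unfolding jp_ideal_def[of R V ?K] by (intro allI conjI ballI sub)
  have "jp_nondegenerate (jp_quotient V ?K)"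
    unfolding jp_nondegenerate_quotient_iff[OF id] K_iff
  proof (intro allI ballI impI)
    fix s z U
    assume z: "z \<in> carrier (jpV V s)"
      "\<forall>y\<in>carrier (jpV V (opp s)). \<forall>U. ?P U \<longrightarrow> jpQ V s z y \<in> U s" and U: "?P U"
    then have "\<forall>y\<in>carrier (jpV V (opp s)). jpQ V s z y \<in> U s" by simp
    then show "z \<in> U s" using z(1) U jp_nondegenerate_quotient_iff[of U] by simp
  qed
  with id have P: "?P ?K" by simp
  have eq: "mccrimmon_radical R V = ?K"
    unfolding mccrimmon_radical_def
    by (rule Least_equality[where P = ?P]) (use P in \<open>auto simp: le_fun_def\<close>)
  show "jp_ideal R V (mccrimmon_radical R V)"
    and "jp_nondegenerate (jp_quotient V (mccrimmon_radical R V))"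
    using P eq by simp_all
  show "mccrimmon_radical R V s \<subseteq> U s"
    if "jp_ideal R V U" "jp_nondegenerate (jp_quotient V U)"
    using that eq by auto
qed

end

theory Submission
  imports Defs
begin

text \<open>Write \<open>K\<close> for the Kostrikin radical of \<open>L\<close>, \<open>M\<close> for the McCrimmon radical of the associated
  pair, \<open>I\<close> for the ideal of \<open>L\<close> that \<open>M\<close> generates, and \<open>J\<close> for \<open>lie_tilde L I\<close>. Both radicals are
  least among the ideals with nondegenerate quotient, so each inclusion amounts to exhibiting one
  nondegenerate quotient.

  For \<open>J \<subseteq> K\<close>, nondegeneracy passes from \<open>L\<close> modulo \<open>K\<close> to the pair modulo the trace of \<open>K\<close>
  (\<open>trace_nondegenerate\<close>): if \<open>z\<close> lies in degree \<open>1\<close> or \<open>-1\<close>, then for degree reasons \<open>(ad z)\<^sup>2\<close>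
  annihilates everything outside the opposite degree, where it is, up to a scalar, the quadratic
  map \<open>Q\<^sub>z\<close>. Hence \<open>M \<subseteq> K\<close>, so \<open>I \<subseteq> K\<close>. Finally \<open>lie_tilde L K \<subseteq> K\<close>, because an element that is
  central modulo \<open>K\<close> is an absolute zero divisor modulo \<open>K\<close>.

  For \<open>K \<subseteq> J\<close>, the quotient by \<open>J\<close> is nondegenerate (\<open>lie_tilde_quotient_nondegenerate\<close>). Let
  \<open>z = a + b + c\<close>, with \<open>b\<close> of degree \<open>0\<close>, be an absolute zero divisor modulo \<open>J\<close>. Comparing
  components of \<open>\<lblot>z, \<lblot>z, y\<rblot>\<^bsub>L\<^esub>\<rblot>\<^bsub>L\<^esub>\<close> for \<open>y\<close> of extreme degree shows that \<open>a\<close> and \<open>c\<close> are absolute zero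
  divisors of the pair modulo \<open>M\<close>, hence lie in \<open>M\<close>; so \<open>b\<close> is an absolute zero divisor modulo
  \<open>J\<close> as well. The derivation \<open>ad b\<close> squares to zero modulo \<open>J\<close>, and this forces
  \<open>\<lblot>\<lblot>b, u\<rblot>\<^bsub>L\<^esub>, \<lblot>b, v\<rblot>\<^bsub>L\<^esub>\<rblot>\<^bsub>L\<^esub> \<in> J\<close> for all \<open>u\<close> and \<open>v\<close>. For \<open>x\<close> of degree \<open>1\<close> or \<open>-1\<close> and \<open>d = \<lblot>b, x\<rblot>\<^bsub>L\<^esub>\<close> it
  follows that \<open>(ad d)\<^sup>2\<close> maps the opposite degree into \<open>J\<close>, since \<open>d\<close> and \<open>x\<close> commute; so
  \<open>d \<in> M\<close>. As \<open>L\<close> is generated by its components of degree \<open>1\<close> and \<open>-1\<close>, the element \<open>b\<close> is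
  central modulo \<open>I\<close>, which says \<open>b \<in> J\<close>.

  The hypothesis on the characteristic makes \<open>2\<close> invertible; this identifies absolute zero
  divisors of the pair with those of the bracket, and cancels the coefficient \<open>2\<close> in the Leibniz
  rule for \<open>(ad b)\<^sup>2\<close>.\<close>

section \<open>Lie algebras\<close>

context lie_algebra
begin

lemma bracket_anticomm:
  assumes x: "x \<in> carrier L" and y: "y \<in> carrier L"
  shows "\<lblot>x, y\<rblot>\<^bsub>L\<^esub> = \<ominus>\<^bsub>L\<^esub> \<lblot>y, x\<rblot>\<^bsub>L\<^esub>"
proof -
  have "\<lblot>x, y\<rblot>\<^bsub>L\<^esub> \<oplus>\<^bsub>L\<^esub> \<lblot>y, x\<rblot>\<^bsub>L\<^esub> = \<lblot>x \<oplus>\<^bsub>L\<^esub> y, x \<oplus>\<^bsub>L\<^esub> y\<rblot>\<^bsub>L\<^esub>"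
    using x y by (simp only: bracket_add_left bracket_add_right bracket_self[OF x] bracket_self[OF y] bracket_closed
        M.add.m_closed M.l_zero M.r_zero M.a_comm)
  also have "\<dots> = \<zero>\<^bsub>L\<^esub>"
    using x y by simp
  finally show ?thesis
    using x y by (simp add: M.minus_equality)
qed

lemma bracket_zero [simp]:
  assumes x: "x \<in> carrier L"
  shows "\<lblot>\<zero>\<^bsub>L\<^esub>, x\<rblot>\<^bsub>L\<^esub> = \<zero>\<^bsub>L\<^esub>" "\<lblot>x, \<zero>\<^bsub>L\<^esub>\<rblot>\<^bsub>L\<^esub> = \<zero>\<^bsub>L\<^esub>"
proof -
  show *: "\<lblot>\<zero>\<^bsub>L\<^esub>, x\<rblot>\<^bsub>L\<^esub> = \<zero>\<^bsub>L\<^esub>"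
    using bracket_add_left[of "\<zero>\<^bsub>L\<^esub>" "\<zero>\<^bsub>L\<^esub>" x] x by simp
  show "\<lblot>x, \<zero>\<^bsub>L\<^esub>\<rblot>\<^bsub>L\<^esub> = \<zero>\<^bsub>L\<^esub>"
    using bracket_anticomm[of x "\<zero>\<^bsub>L\<^esub>"] x * by simp
qed

lemma bracket_minus_left:
  assumes "x \<in> carrier L" "y \<in> carrier L"
  shows "\<lblot>\<ominus>\<^bsub>L\<^esub> x, y\<rblot>\<^bsub>L\<^esub> = \<ominus>\<^bsub>L\<^esub> \<lblot>x, y\<rblot>\<^bsub>L\<^esub>"
proof -
  have "\<lblot>\<ominus>\<^bsub>L\<^esub> x, y\<rblot>\<^bsub>L\<^esub> \<oplus>\<^bsub>L\<^esub> \<lblot>x, y\<rblot>\<^bsub>L\<^esub> = \<zero>\<^bsub>L\<^esub>"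
    using bracket_add_left[of "\<ominus>\<^bsub>L\<^esub> x" x y] assms by (simp add: M.l_neg)
  then show ?thesis
    using assms by (simp add: M.minus_equality)
qed

lemma bracket_minus_right:
  assumes "x \<in> carrier L" "y \<in> carrier L"
  shows "\<lblot>x, \<ominus>\<^bsub>L\<^esub> y\<rblot>\<^bsub>L\<^esub> = \<ominus>\<^bsub>L\<^esub> \<lblot>x, y\<rblot>\<^bsub>L\<^esub>"
  using assms by (metis bracket_anticomm bracket_minus_left M.a_inv_closed)

text \<open>The Jacobi identity in the form used throughout: \<open>ad x\<close> is a derivation.\<close>

lemma bracket_leibniz:
  assumes x: "x \<in> carrier L" and y: "y \<in> carrier L" and z: "z \<in> carrier L"
  shows "\<lblot>x, \<lblot>y, z\<rblot>\<^bsub>L\<^esub>\<rblot>\<^bsub>L\<^esub> = \<lblot>\<lblot>x, y\<rblot>\<^bsub>L\<^esub>, z\<rblot>\<^bsub>L\<^esub> \<oplus>\<^bsub>L\<^esub> \<lblot>y, \<lblot>x, z\<rblot>\<^bsub>L\<^esub>\<rblot>\<^bsub>L\<^esub>"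
proof -
  have 1: "\<lblot>y, \<lblot>z, x\<rblot>\<^bsub>L\<^esub>\<rblot>\<^bsub>L\<^esub> = \<ominus>\<^bsub>L\<^esub> \<lblot>y, \<lblot>x, z\<rblot>\<^bsub>L\<^esub>\<rblot>\<^bsub>L\<^esub>"
    using bracket_anticomm[of z x] assms by (simp add: bracket_minus_right)
  have 2: "\<lblot>z, \<lblot>x, y\<rblot>\<^bsub>L\<^esub>\<rblot>\<^bsub>L\<^esub> = \<ominus>\<^bsub>L\<^esub> \<lblot>\<lblot>x, y\<rblot>\<^bsub>L\<^esub>, z\<rblot>\<^bsub>L\<^esub>"
    using bracket_anticomm[of z "\<lblot>x, y\<rblot>\<^bsub>L\<^esub>"] assms by simp
  have "\<lblot>x, \<lblot>y, z\<rblot>\<^bsub>L\<^esub>\<rblot>\<^bsub>L\<^esub> \<oplus>\<^bsub>L\<^esub> \<ominus>\<^bsub>L\<^esub> (\<lblot>\<lblot>x, y\<rblot>\<^bsub>L\<^esub>, z\<rblot>\<^bsub>L\<^esub> \<oplus>\<^bsub>L\<^esub> \<lblot>y, \<lblot>x, z\<rblot>\<^bsub>L\<^esub>\<rblot>\<^bsub>L\<^esub>) = \<zero>\<^bsub>L\<^esub>"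
    using jacobi[OF x y z] assms unfolding 1 2 by (simp add: M.minus_add M.a_ac)
  then show ?thesis
    using assms by (metis M.add.m_closed M.add.inv_solve_right' M.l_zero bracket_closed M.zero_closed)
qed

lemma lie_ideal_left:
  assumes I: "lie_ideal R L I" and "x \<in> carrier L" "y \<in> I"
  shows "\<lblot>x, y\<rblot>\<^bsub>L\<^esub> \<in> I"
proof -
  have S: "submodule I R L"
    using I by (simp add: lie_ideal_def)
  have "\<lblot>y, x\<rblot>\<^bsub>L\<^esub> \<in> I" "y \<in> carrier L"
    using assms submoduleE(1)[OF S] by (auto simp: lie_ideal_def)
  then show ?thesis
    using bracket_anticomm[of x y] assms(2) submoduleE(3)[OF S] by simp
qed

lemma submodule_double_mem:
  assumes two: "\<one> \<oplus> \<one> \<in> Units R" and H: "submodule H R L"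
    and x: "x \<in> carrier L" "x \<oplus>\<^bsub>L\<^esub> x \<in> H"
  shows "x \<in> H"
proof -
  have "x \<oplus>\<^bsub>L\<^esub> x = (\<one> \<oplus> \<one>) \<odot>\<^bsub>L\<^esub> x"
    using x by (simp add: smult_l_distr)
  then have "inv (\<one> \<oplus> \<one>) \<odot>\<^bsub>L\<^esub> (x \<oplus>\<^bsub>L\<^esub> x) = x"
    using x two by (simp add: smult_assoc1[symmetric] R.Units_l_inv)
  then show ?thesis
    using submoduleE(4)[OF H _ x(2)] two by (metis R.Units_inv_closed)
qed

lemma submodule_cancel:
  assumes H: "submodule H R L" and "x \<oplus>\<^bsub>L\<^esub> y \<in> H" "y \<in> H" "x \<in> carrier L"
  shows "x \<in> H"
proof -
  have y: "y \<in> carrier L"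
    using submoduleE(1)[OF H] assms by auto
  have "(x \<oplus>\<^bsub>L\<^esub> y) \<oplus>\<^bsub>L\<^esub> \<ominus>\<^bsub>L\<^esub> y \<in> H"
    using submoduleE(3,5)[OF H] assms by simp
  then show ?thesis
    using assms y by (simp add: M.a_assoc M.r_neg)
qed

text \<open>Modulo \<open>J\<close>, the square of the derivation \<open>ad z\<close> vanishes, so applying it to \<open>\<lblot>u, v\<rblot>\<^bsub>L\<^esub>\<close> leaves
  only the mixed term of the Leibniz rule, twice.\<close>

lemma absolute_zero_divisor_brackets_commute:
  assumes two: "\<one> \<oplus> \<one> \<in> Units R" and J: "lie_ideal R L J"
    and z: "z \<in> carrier L" "\<forall>w\<in>carrier L. \<lblot>z, \<lblot>z, w\<rblot>\<^bsub>L\<^esub>\<rblot>\<^bsub>L\<^esub> \<in> J"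
    and u: "u \<in> carrier L" and v: "v \<in> carrier L"
  shows "\<lblot>\<lblot>z, u\<rblot>\<^bsub>L\<^esub>, \<lblot>z, v\<rblot>\<^bsub>L\<^esub>\<rblot>\<^bsub>L\<^esub> \<in> J"
proof -
  have S: "submodule J R L"
    using J by (simp add: lie_ideal_def)
  let ?w = "\<lblot>\<lblot>z, u\<rblot>\<^bsub>L\<^esub>, \<lblot>z, v\<rblot>\<^bsub>L\<^esub>\<rblot>\<^bsub>L\<^esub>"
  have "\<lblot>z, \<lblot>z, \<lblot>u, v\<rblot>\<^bsub>L\<^esub>\<rblot>\<^bsub>L\<^esub>\<rblot>\<^bsub>L\<^esub> =
      (\<lblot>\<lblot>z, \<lblot>z, u\<rblot>\<^bsub>L\<^esub>\<rblot>\<^bsub>L\<^esub>, v\<rblot>\<^bsub>L\<^esub> \<oplus>\<^bsub>L\<^esub> ?w) \<oplus>\<^bsub>L\<^esub> (?w \<oplus>\<^bsub>L\<^esub> \<lblot>u, \<lblot>z, \<lblot>z, v\<rblot>\<^bsub>L\<^esub>\<rblot>\<^bsub>L\<^esub>\<rblot>\<^bsub>L\<^esub>)"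
    using z(1) u v by (simp add: bracket_add_right bracket_leibniz[of z u]
        bracket_leibniz[of z "\<lblot>z, u\<rblot>\<^bsub>L\<^esub>"] bracket_leibniz[of z u "\<lblot>z, v\<rblot>\<^bsub>L\<^esub>"])
  also have "\<dots> = (?w \<oplus>\<^bsub>L\<^esub> ?w) \<oplus>\<^bsub>L\<^esub> (\<lblot>\<lblot>z, \<lblot>z, u\<rblot>\<^bsub>L\<^esub>\<rblot>\<^bsub>L\<^esub>, v\<rblot>\<^bsub>L\<^esub> \<oplus>\<^bsub>L\<^esub> \<lblot>u, \<lblot>z, \<lblot>z, v\<rblot>\<^bsub>L\<^esub>\<rblot>\<^bsub>L\<^esub>\<rblot>\<^bsub>L\<^esub>)"
    using z(1) u v by (simp add: M.a_ac)
  finally have "(?w \<oplus>\<^bsub>L\<^esub> ?w) \<oplus>\<^bsub>L\<^esub> (\<lblot>\<lblot>z, \<lblot>z, u\<rblot>\<^bsub>L\<^esub>\<rblot>\<^bsub>L\<^esub>, v\<rblot>\<^bsub>L\<^esub> \<oplus>\<^bsub>L\<^esub> \<lblot>u, \<lblot>z, \<lblot>z, v\<rblot>\<^bsub>L\<^esub>\<rblot>\<^bsub>L\<^esub>\<rblot>\<^bsub>L\<^esub>) \<in> J"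
    using z u v by (metis bracket_closed)
  moreover have "\<lblot>\<lblot>z, \<lblot>z, u\<rblot>\<^bsub>L\<^esub>\<rblot>\<^bsub>L\<^esub>, v\<rblot>\<^bsub>L\<^esub> \<oplus>\<^bsub>L\<^esub> \<lblot>u, \<lblot>z, \<lblot>z, v\<rblot>\<^bsub>L\<^esub>\<rblot>\<^bsub>L\<^esub>\<rblot>\<^bsub>L\<^esub> \<in> J"
    using z u v J by (intro submoduleE(5)[OF S]) (auto simp: lie_ideal_def intro: lie_ideal_left[OF J])
  ultimately have "?w \<oplus>\<^bsub>L\<^esub> ?w \<in> J"
    using submodule_cancel[OF S] z(1) u v by simp
  then show ?thesis
    using submodule_double_mem[OF two S, of ?w] z(1) u v by simp
qed

lemma lie_ideal_tilde:
  assumes I: "lie_ideal R L I"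
  shows "lie_ideal R L (lie_tilde L I)" and "I \<subseteq> lie_tilde L I"
proof -
  have S: "submodule I R L"
    using I by (simp add: lie_ideal_def)
  note SI = S[unfolded submodule_iff]
  have "submodule (lie_tilde L I) R L"
    unfolding submodule_iff
    using SI by (auto simp: lie_tilde_def bracket_add_left bracket_smult_left)
  moreover show sub: "I \<subseteq> lie_tilde L I"
    using I SI by (auto simp: lie_ideal_def lie_tilde_def)
  ultimately show "lie_ideal R L (lie_tilde L I)"
    using sub by (auto simp: lie_ideal_def lie_tilde_def)
qed

lemma lie_tilde_subset_if_nondegenerate:
  assumes I: "lie_ideal R L I" and nd: "lie_nondegenerate (lie_quotient L I)"
  shows "lie_tilde L I \<subseteq> I"
proof
  fix x assume "x \<in> lie_tilde L I"
  then have x: "x \<in> carrier L" "\<forall>y\<in>carrier L. \<lblot>x, y\<rblot>\<^bsub>L\<^esub> \<in> I"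
    by (auto simp: lie_tilde_def)
  then show "x \<in> I"
    using nd[unfolded lie_nondegenerate_quotient_iff[OF I]] by simp
qed

lemma set_add_iff: "x \<in> A <+>\<^bsub>L\<^esub> B \<longleftrightarrow> (\<exists>a\<in>A. \<exists>b\<in>B. x = a \<oplus>\<^bsub>L\<^esub> b)"
  by (auto simp: set_add_def')

lemma submodule_set_add:
  assumes A: "submodule A R L" and B: "submodule B R L"
  shows "submodule (A <+>\<^bsub>L\<^esub> B) R L"
  unfolding submodule_iff
proof (intro conjI ballI subsetI)
  note cA = subsetD[OF submoduleE(1)[OF A]] and cB = subsetD[OF submoduleE(1)[OF B]]
  show "x \<in> carrier L" if "x \<in> A <+>\<^bsub>L\<^esub> B" for x
    using that cA cB by (auto simp: set_add_iff)
  show "\<zero>\<^bsub>L\<^esub> \<in> A <+>\<^bsub>L\<^esub> B"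
    unfolding set_add_iff
    using A B by (intro bexI[of _ "\<zero>\<^bsub>L\<^esub>"]) (auto simp: submodule_iff)
  show "x \<oplus>\<^bsub>L\<^esub> y \<in> A <+>\<^bsub>L\<^esub> B" if xy: "x \<in> A <+>\<^bsub>L\<^esub> B" "y \<in> A <+>\<^bsub>L\<^esub> B" for x y
  proof -
    obtain a b a' b' where *: "a \<in> A" "b \<in> B" "a' \<in> A" "b' \<in> B" "x = a \<oplus>\<^bsub>L\<^esub> b" "y = a' \<oplus>\<^bsub>L\<^esub> b'"
      using xy unfolding set_add_iff by blast
    then have "x \<oplus>\<^bsub>L\<^esub> y = (a \<oplus>\<^bsub>L\<^esub> a') \<oplus>\<^bsub>L\<^esub> (b \<oplus>\<^bsub>L\<^esub> b')"
      using cA cB by (simp add: M.a_ac)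
    then show ?thesis
      unfolding set_add_iff using * submoduleE(5)[OF A] submoduleE(5)[OF B] by blast
  qed
  show "r \<odot>\<^bsub>L\<^esub> x \<in> A <+>\<^bsub>L\<^esub> B" if r: "r \<in> carrier R" and x: "x \<in> A <+>\<^bsub>L\<^esub> B" for r x
  proof -
    obtain a b where *: "a \<in> A" "b \<in> B" "x = a \<oplus>\<^bsub>L\<^esub> b"
      using x unfolding set_add_iff by blast
    then have "r \<odot>\<^bsub>L\<^esub> x = r \<odot>\<^bsub>L\<^esub> a \<oplus>\<^bsub>L\<^esub> r \<odot>\<^bsub>L\<^esub> b"
      using cA cB r by (simp add: smult_r_distr)
    then show ?thesis
      unfolding set_add_iff using * r submoduleE(4)[OF A] submoduleE(4)[OF B] by blast
  qed
qed

lemma subset_set_add: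
  assumes "submodule A R L" "submodule B R L"
  shows "A \<subseteq> A <+>\<^bsub>L\<^esub> B" "B \<subseteq> A <+>\<^bsub>L\<^esub> B"
proof -
  note c = subsetD[OF submoduleE(1)[OF assms(1)]] subsetD[OF submoduleE(1)[OF assms(2)]]
  show "A \<subseteq> A <+>\<^bsub>L\<^esub> B"
  proof
    fix x assume "x \<in> A"
    then have "x = x \<oplus>\<^bsub>L\<^esub> \<zero>\<^bsub>L\<^esub>" "x \<in> A"
      using c by auto
    then show "x \<in> A <+>\<^bsub>L\<^esub> B"
      using assms(2) unfolding set_add_iff submodule_iff by blast
  qed
  show "B \<subseteq> A <+>\<^bsub>L\<^esub> B"
  proof
    fix x assume "x \<in> B"
    then have "x = \<zero>\<^bsub>L\<^esub> \<oplus>\<^bsub>L\<^esub> x" "x \<in> B"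
      using c by auto
    then show "x \<in> A <+>\<^bsub>L\<^esub> B"
      using assms(1) unfolding set_add_iff submodule_iff by blast
  qed
qed

lemma set_add_subset:
  assumes "submodule H R L" "A \<subseteq> H" "B \<subseteq> H"
  shows "A <+>\<^bsub>L\<^esub> B \<subseteq> H"
proof
  fix x assume "x \<in> A <+>\<^bsub>L\<^esub> B"
  then show "x \<in> H"
    using assms(2,3) submoduleE(5)[OF assms(1)] unfolding set_add_iff by blast
qed

lemma bracket_span_submodule:
  assumes "A \<subseteq> carrier L" "B \<subseteq> carrier L"
  shows "submodule (bracket_span R L A B) R L"
  unfolding bracket_span_def hull_def
  using assms carrier_is_submodule by (intro submodule_Inter) auto

lemma bracket_in_span:
  "\<lbrakk>x \<in> A; y \<in> B\<rbrakk> \<Longrightarrow> \<lblot>x, y\<rblot>\<^bsub>L\<^esub> \<in> bracket_span R L A B"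
  unfolding bracket_span_def by (rule hull_inc) auto

lemma bracket_span_minimal:
  assumes "submodule H R L" "\<And>x y. \<lbrakk>x \<in> A; y \<in> B\<rbrakk> \<Longrightarrow> \<lblot>x, y\<rblot>\<^bsub>L\<^esub> \<in> H"
  shows "bracket_span R L A B \<subseteq> H"
  unfolding bracket_span_def using assms by (intro hull_minimal) auto

lemma bracket_span_commute_subset:
  assumes A: "A \<subseteq> carrier L" and B: "B \<subseteq> carrier L"
  shows "bracket_span R L A B \<subseteq> bracket_span R L B A"
proof (rule bracket_span_minimal)
  show S: "submodule (bracket_span R L B A) R L"
    by (rule bracket_span_submodule[OF B A])
  fix x y assume xy: "x \<in> A" "y \<in> B"
  then have "\<ominus>\<^bsub>L\<^esub> \<lblot>y, x\<rblot>\<^bsub>L\<^esub> \<in> bracket_span R L B A"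
    using submoduleE(3)[OF S] bracket_in_span by blast
  then show "\<lblot>x, y\<rblot>\<^bsub>L\<^esub> \<in> bracket_span R L B A"
    using bracket_anticomm[of x y] subsetD[OF A xy(1)] subsetD[OF B xy(2)] by simp
qed

lemma bracket_span_commute:
  assumes "A \<subseteq> carrier L" "B \<subseteq> carrier L"
  shows "bracket_span R L A B = bracket_span R L B A"
  using bracket_span_commute_subset assms by blast

end

section \<open>The associated Jordan pair\<close>

context jordan_3graded_lie_algebra
begin

abbreviation V where "V \<equiv> associated_jpair R L G"

lemma G_carrier: "x \<in> G i \<Longrightarrow> x \<in> carrier L"
  using G_submodule submoduleE(1) by blast

lemma zero_in_G: "\<zero>\<^bsub>L\<^esub> \<in> G i"
  using G_submodule submodule_iff by blast

lemma G_add: "\<lbrakk>x \<in> G i; y \<in> G i\<rbrakk> \<Longrightarrow> x \<oplus>\<^bsub>L\<^esub> y \<in> G i"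
  using G_submodule submodule_iff by blast

lemma G_bracket_same_sign:
  assumes "x \<in> G (sign_int s)" "y \<in> G (sign_int s)"
  shows "\<lblot>x, y\<rblot>\<^bsub>L\<^esub> = \<zero>\<^bsub>L\<^esub>"
  using G_bracket[OF assms] G_zero[of "sign_int s + sign_int s"] by (cases s) auto

lemma G_bracket_opp:
  assumes "x \<in> G (sign_int s)" "y \<in> G (sign_int (opp s))"
  shows "\<lblot>x, y\<rblot>\<^bsub>L\<^esub> \<in> G 0" "\<lblot>y, x\<rblot>\<^bsub>L\<^esub> \<in> G 0"
  using G_bracket[OF assms] G_bracket[OF assms(2,1)] by (cases s; simp)+

lemma G_bracket_0_sign:
  assumes "x \<in> G 0" "y \<in> G (sign_int s)"
  shows "\<lblot>x, y\<rblot>\<^bsub>L\<^esub> \<in> G (sign_int s)" "\<lblot>y, x\<rblot>\<^bsub>L\<^esub> \<in> G (sign_int s)"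
  using G_bracket[OF assms] G_bracket[OF assms(2,1)] by simp_all

text \<open>The symmetry in the sign lets all later arguments treat both extreme degrees at once.\<close>

lemma G_0_span: "G 0 = bracket_span R L (G (sign_int s)) (G (sign_int (opp s)))"
  using G_bracket_span bracket_span_commute[of "G 1" "G (-1)"] G_carrier
  by (cases s) auto

lemma G_decompose:
  assumes "x \<in> carrier L"
  obtains a b c where "a \<in> G (sign_int s)" "b \<in> G 0" "c \<in> G (sign_int (opp s))"
    "x = a \<oplus>\<^bsub>L\<^esub> b \<oplus>\<^bsub>L\<^esub> c"
proof -
  obtain a b c where abc: "a \<in> G 1" "b \<in> G 0" "c \<in> G (-1)" "x = a \<oplus>\<^bsub>L\<^esub> b \<oplus>\<^bsub>L\<^esub> c"
    using G_direct_sum[OF assms] by auto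
  moreover have "x = c \<oplus>\<^bsub>L\<^esub> b \<oplus>\<^bsub>L\<^esub> a"
    using abc G_carrier by (simp add: M.a_ac)
  ultimately show ?thesis
    using that by (cases s) auto
qed

text \<open>The directness of the sum, read from either end of the grading.\<close>

lemma G_decompose_unique:
  assumes "a \<in> G (sign_int s)" "b \<in> G 0" "c \<in> G (sign_int (opp s))"
    and "a' \<in> G (sign_int s)" "b' \<in> G 0" "c' \<in> G (sign_int (opp s))"
    and eq: "a \<oplus>\<^bsub>L\<^esub> b \<oplus>\<^bsub>L\<^esub> c = a' \<oplus>\<^bsub>L\<^esub> b' \<oplus>\<^bsub>L\<^esub> c'"
  shows "a = a' \<and> b = b' \<and> c = c'"
proof -
  have ex1_unique: "p = q" if "\<exists>!p. P p" "P p" "P q" for P and p q :: "'a \<times> 'a \<times> 'a"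
    using that by blast
  have *: "a = a' \<and> b = b' \<and> c = c'"
    if "a \<in> G 1" "b \<in> G 0" "c \<in> G (-1)" "a' \<in> G 1" "b' \<in> G 0" "c' \<in> G (-1)"
      "a \<oplus>\<^bsub>L\<^esub> b \<oplus>\<^bsub>L\<^esub> c = a' \<oplus>\<^bsub>L\<^esub> b' \<oplus>\<^bsub>L\<^esub> c'" for a b c a' b' c'
  proof -
    have "a \<oplus>\<^bsub>L\<^esub> b \<oplus>\<^bsub>L\<^esub> c \<in> carrier L"
      using that G_carrier by simp
    from ex1_unique[OF G_direct_sum[OF this], of "(a, b, c)" "(a', b', c')"] show ?thesis
      using that by simp
  qed
  have rev: "z \<oplus>\<^bsub>L\<^esub> y \<oplus>\<^bsub>L\<^esub> x = x \<oplus>\<^bsub>L\<^esub> y \<oplus>\<^bsub>L\<^esub> z"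
    if "x \<in> carrier L" "y \<in> carrier L" "z \<in> carrier L" for x y z
    using that by (simp add: M.a_ac)
  have "c \<oplus>\<^bsub>L\<^esub> b \<oplus>\<^bsub>L\<^esub> a = c' \<oplus>\<^bsub>L\<^esub> b' \<oplus>\<^bsub>L\<^esub> a'"
    using eq assms(1-6)[THEN G_carrier] by (simp only: rev)
  then show ?thesis
    using assms *[of a b c a' b' c'] *[of c b a c' b' a'] by (cases s) auto
qed

lemma V_simps [simp]:
  "carrier (jpV V s) = G (sign_int s)"
  "add (jpV V s) = add L" "zero (jpV V s) = \<zero>\<^bsub>L\<^esub>" "smult (jpV V s) = smult L"
  by (simp_all add: associated_jpair_def)

lemma submodule_V_iff:
  "submodule H R (jpV V s) \<longleftrightarrow> submodule H R L \<and> H \<subseteq> G (sign_int s)"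
  using G_carrier
  by (auto simp: module.submodule_iff[OF jordan_pair.jp_module[OF jordan_pair]] submodule_iff)

lemma double_bracket_flip:
  assumes "x \<in> carrier L" "y \<in> carrier L"
  shows "\<lblot>\<lblot>x, y\<rblot>\<^bsub>L\<^esub>, x\<rblot>\<^bsub>L\<^esub> = \<ominus>\<^bsub>L\<^esub> \<lblot>x, \<lblot>x, y\<rblot>\<^bsub>L\<^esub>\<rblot>\<^bsub>L\<^esub>"
  using assms by (intro bracket_anticomm) auto

text \<open>As \<open>2\<close> is invertible, \<open>Q\<^sub>x y\<close> and \<open>(ad x)\<^sup>2 y\<close> differ by the unit \<open>-1/2\<close>.\<close>

lemma jpQ_mem_iff:
  assumes two: "\<one> \<oplus> \<one> \<in> Units R" and H: "submodule H R L"
    and x: "x \<in> carrier L" and y: "y \<in> carrier L"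
  shows "jpQ V s x y \<in> H \<longleftrightarrow> \<lblot>x, \<lblot>x, y\<rblot>\<^bsub>L\<^esub>\<rblot>\<^bsub>L\<^esub> \<in> H"
proof -
  let ?q = "\<lblot>x, \<lblot>x, y\<rblot>\<^bsub>L\<^esub>\<rblot>\<^bsub>L\<^esub>" and ?h = "inv (\<one> \<oplus> \<one>)"
  have Q: "jpQ V s x y = ?h \<odot>\<^bsub>L\<^esub> (\<ominus>\<^bsub>L\<^esub> ?q)"
    using x y by (simp add: associated_jpair_def double_bracket_flip)
  have "(\<one> \<oplus> \<one>) \<odot>\<^bsub>L\<^esub> jpQ V s x y = \<ominus>\<^bsub>L\<^esub> ?q"
    using x y two unfolding Q by (simp add: smult_assoc1[symmetric] R.Units_r_inv)
  then have "\<ominus>\<^bsub>L\<^esub> ?q \<in> H" if "jpQ V s x y \<in> H"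
    using submoduleE(4)[OF H _ that, of "\<one> \<oplus> \<one>"] by simp
  then have "\<ominus>\<^bsub>L\<^esub> (\<ominus>\<^bsub>L\<^esub> ?q) \<in> H" if "jpQ V s x y \<in> H"
    using submoduleE(3)[OF H] that by blast
  moreover have "jpQ V s x y \<in> H" if "?q \<in> H"
    unfolding Q using that submoduleE(3,4)[OF H] two by (simp add: R.Units_inv_closed)
  ultimately show ?thesis
    using x y by auto
qed

lemma jp_nondegenerate_quotient_V_iff:
  assumes two: "\<one> \<oplus> \<one> \<in> Units R" and U: "jp_ideal R V U"
  shows "jp_nondegenerate (jp_quotient V U) \<longleftrightarrow>
    (\<forall>s. \<forall>z\<in>G (sign_int s). (\<forall>y\<in>G (sign_int (opp s)). \<lblot>z, \<lblot>z, y\<rblot>\<^bsub>L\<^esub>\<rblot>\<^bsub>L\<^esub> \<in> U s) \<longrightarrow> z \<in> U s)"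
proof -
  have S: "submodule (U s) R L" for s
    using U by (auto simp: jp_ideal_def submodule_V_iff)
  show ?thesis
    unfolding jordan_pair.jp_nondegenerate_quotient_iff[OF jordan_pair U]
    using jpQ_mem_iff[OF two S] G_carrier by simp
qed

section \<open>The ideal of a Lie algebra generated by a pair ideal\<close>

context
  fixes U assumes U: "jp_ideal R V U"
begin

lemma jp_ideal_submodule: "submodule (U s) R L"
  using U by (auto simp: jp_ideal_def submodule_V_iff)

lemma jp_ideal_G: "u \<in> U s \<Longrightarrow> u \<in> G (sign_int s)"
  using U by (auto simp: jp_ideal_def submodule_V_iff)

lemma jp_ideal_carrier: "u \<in> U s \<Longrightarrow> u \<in> carrier L"
  using jp_ideal_G G_carrier by blast

lemma jp_ideal_triple_outer:
  assumes "x \<in> G (sign_int s)" "y \<in> G (sign_int (opp s))" "u \<in> U s"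
  shows "\<lblot>\<lblot>x, y\<rblot>\<^bsub>L\<^esub>, u\<rblot>\<^bsub>L\<^esub> \<in> U s"
proof -
  have "jp_triple V s x y u \<in> U s"
    using assms U by (simp add: jp_ideal_def)
  then show ?thesis
    using triple_product[OF assms(1,2) jp_ideal_G[OF assms(3)]] by simp
qed

text \<open>The triple product is the polarization of \<open>Q\<^sub>x u\<close> in \<open>x\<close>, and \<open>Q\<^sub>x u\<close> lies in the ideal for
  every \<open>x\<close>.\<close>

lemma jp_ideal_triple_middle:
  assumes x: "x \<in> G (sign_int s)" and u: "u \<in> U (opp s)" and z: "z \<in> G (sign_int s)"
  shows "\<lblot>\<lblot>x, u\<rblot>\<^bsub>L\<^esub>, z\<rblot>\<^bsub>L\<^esub> \<in> U s"
proof -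
  have Q: "jpQ V s w u \<in> U s" if "w \<in> G (sign_int s)" for w
    using U that u by (simp add: jp_ideal_def)
  have S: "submodule (U s) R (jpV V s)"
    using U by (simp add: jp_ideal_def)
  interpret W: module R "jpV V s"
    by (rule jordan_pair.jp_module[OF jordan_pair])
  have "jp_triple V s x u z \<in> U s"
    unfolding jp_triple_def W.M.minus_eq
    using Q x z G_add W.submoduleE(3,5)[OF S] by simp
  then show ?thesis
    using triple_product[OF x jp_ideal_G[OF u] z] by simp
qed

text \<open>Two elements of the same extreme degree commute, so the triple product is symmetric in its
  outer entries.\<close>

lemma jp_ideal_triple_left:
  assumes u: "u \<in> U s" and y: "y \<in> G (sign_int (opp s))" and x: "x \<in> G (sign_int s)"
  shows "\<lblot>\<lblot>u, y\<rblot>\<^bsub>L\<^esub>, x\<rblot>\<^bsub>L\<^esub> \<in> U s"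
proof -
  have c: "u \<in> carrier L" "x \<in> carrier L" "y \<in> carrier L"
    using u x y jp_ideal_carrier G_carrier by auto
  have ux: "\<lblot>u, x\<rblot>\<^bsub>L\<^esub> = \<zero>\<^bsub>L\<^esub>"
    using G_bracket_same_sign[OF jp_ideal_G[OF u] x] .
  have "\<lblot>x, \<lblot>u, y\<rblot>\<^bsub>L\<^esub>\<rblot>\<^bsub>L\<^esub> = \<lblot>u, \<lblot>x, y\<rblot>\<^bsub>L\<^esub>\<rblot>\<^bsub>L\<^esub>"
    using bracket_leibniz[of u x y] c ux by simp
  then have "\<lblot>\<lblot>u, y\<rblot>\<^bsub>L\<^esub>, x\<rblot>\<^bsub>L\<^esub> = \<lblot>\<lblot>x, y\<rblot>\<^bsub>L\<^esub>, u\<rblot>\<^bsub>L\<^esub>"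
    using bracket_anticomm[of "\<lblot>u, y\<rblot>\<^bsub>L\<^esub>" x] bracket_anticomm[of "\<lblot>x, y\<rblot>\<^bsub>L\<^esub>" u] c by simp
  then show ?thesis
    using jp_ideal_triple_outer[OF x y u] by simp
qed

text \<open>Degree \<open>0\<close> is spanned by brackets \<open>\<lblot>x, y\<rblot>\<^bsub>L\<^esub>\<close> of opposite extreme degrees, and these act on the
  pair by triple products.\<close>

lemma jp_ideal_G_0_invariant:
  assumes u: "u \<in> U s" and w: "w \<in> G 0"
  shows "\<lblot>w, u\<rblot>\<^bsub>L\<^esub> \<in> U s" "\<lblot>u, w\<rblot>\<^bsub>L\<^esub> \<in> U s"
proof -
  have "G 0 \<subseteq> {w \<in> carrier L. \<lblot>w, u\<rblot>\<^bsub>L\<^esub> \<in> U s}"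
    unfolding G_0_span[of s]
  proof (rule bracket_span_minimal)
    show "submodule {w \<in> carrier L. \<lblot>w, u\<rblot>\<^bsub>L\<^esub> \<in> U s} R L"
      using jp_ideal_submodule[of s] jp_ideal_carrier[OF u]
      by (auto simp: submodule_iff bracket_add_left bracket_smult_left)
  qed (use jp_ideal_triple_outer u G_carrier in auto)
  then show *: "\<lblot>w, u\<rblot>\<^bsub>L\<^esub> \<in> U s"
    using w by auto
  show "\<lblot>u, w\<rblot>\<^bsub>L\<^esub> \<in> U s"
    using bracket_anticomm[OF jp_ideal_carrier[OF u] G_carrier[OF w]] *
      submoduleE(3)[OF jp_ideal_submodule] by auto
qed

abbreviation I where "I \<equiv> pair_ideal_to_lie R L G U"

definition I0 where
  "I0 = bracket_span R L (U Pos) (G (-1)) <+>\<^bsub>L\<^esub> bracket_span R L (G 1) (U Neg)"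

lemma I0_submodule: "submodule I0 R L"
  unfolding I0_def
  using jp_ideal_carrier G_carrier by (intro submodule_set_add bracket_span_submodule) auto

lemma bracket_in_I0:
  assumes "u \<in> U s" "y \<in> G (sign_int (opp s))"
  shows "\<lblot>u, y\<rblot>\<^bsub>L\<^esub> \<in> I0"
proof -
  let ?A = "bracket_span R L (U Pos) (G (-1))" and ?B = "bracket_span R L (G 1) (U Neg)"
  have S: "submodule ?A R L" "submodule ?B R L"
    using jp_ideal_carrier G_carrier by (auto intro!: bracket_span_submodule)
  have "?B = bracket_span R L (U Neg) (G 1)"
    using jp_ideal_carrier G_carrier by (intro bracket_span_commute) auto
  then have "\<lblot>u, y\<rblot>\<^bsub>L\<^esub> \<in> ?A \<union> ?B"
    using assms bracket_in_span[of u "U s" y "G (sign_int (opp s))"] by (cases s) auto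
  then show ?thesis
    using subset_set_add[OF S] unfolding I0_def by blast
qed

text \<open>The description of \<open>I0\<close> that does not depend on the order of the factors in its two spans.\<close>

lemma I0_minimal:
  assumes H: "submodule H R L"
    and gen: "\<And>s u y. \<lbrakk>u \<in> U s; y \<in> G (sign_int (opp s))\<rbrakk> \<Longrightarrow> \<lblot>u, y\<rblot>\<^bsub>L\<^esub> \<in> H"
  shows "I0 \<subseteq> H"
  unfolding I0_def
proof (rule set_add_subset[OF H])
  show "bracket_span R L (U Pos) (G (-1)) \<subseteq> H"
    using gen[of _ Pos] by (intro bracket_span_minimal[OF H]) auto
  have "bracket_span R L (U Neg) (G 1) \<subseteq> H"
    using gen[of _ Neg] by (intro bracket_span_minimal[OF H]) auto
  then show "bracket_span R L (G 1) (U Neg) \<subseteq> H"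
    using bracket_span_commute[of "G 1" "U Neg"] jp_ideal_carrier G_carrier
    by (simp add: subset_iff)
qed

lemma I_eq: "I = U Pos <+>\<^bsub>L\<^esub> I0 <+>\<^bsub>L\<^esub> U Neg"
  by (simp add: pair_ideal_to_lie_def I0_def)

lemma I0_subset_G: "I0 \<subseteq> G 0"
  using I0_minimal[OF G_submodule] G_bracket_opp jp_ideal_G by blast

lemma I_iff:
  "x \<in> I \<longleftrightarrow> (\<exists>a\<in>U s. \<exists>b\<in>I0. \<exists>c\<in>U (opp s). x = a \<oplus>\<^bsub>L\<^esub> b \<oplus>\<^bsub>L\<^esub> c)"
proof -
  have "x \<in> I \<longleftrightarrow> (\<exists>a\<in>U Pos. \<exists>b\<in>I0. \<exists>c\<in>U Neg. x = a \<oplus>\<^bsub>L\<^esub> b \<oplus>\<^bsub>L\<^esub> c)"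
    by (simp add: I_eq set_add_iff Bex_def) blast
  moreover have "a \<oplus>\<^bsub>L\<^esub> b \<oplus>\<^bsub>L\<^esub> c = c \<oplus>\<^bsub>L\<^esub> b \<oplus>\<^bsub>L\<^esub> a" if "a \<in> U Pos" "b \<in> I0" "c \<in> U Neg" for a b c
    using that jp_ideal_carrier I0_subset_G G_carrier[of b 0] by (simp add: M.a_ac subset_iff)
  ultimately show ?thesis
    by (cases s) (simp, metis opp.simps(2))
qed

lemma I_submodule: "submodule I R L"
  unfolding I_eq
  using I0_submodule jp_ideal_submodule by (intro submodule_set_add) auto

lemma U_subset_I: "U s \<subseteq> I" and I0_subset_I: "I0 \<subseteq> I"
proof -
  have "U Pos <+>\<^bsub>L\<^esub> I0 \<subseteq> I" "U Neg \<subseteq> I"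
    unfolding I_eq by (intro subset_set_add submodule_set_add I0_submodule jp_ideal_submodule)+
  moreover have "U Pos \<subseteq> U Pos <+>\<^bsub>L\<^esub> I0" "I0 \<subseteq> U Pos <+>\<^bsub>L\<^esub> I0"
    by (intro subset_set_add I0_submodule jp_ideal_submodule)+
  ultimately show "U s \<subseteq> I" "I0 \<subseteq> I"
    by (cases s; blast)+
qed

text \<open>The ideal is graded: it contains the components of each of its elements.\<close>

lemma I_components:
  assumes "a \<in> G (sign_int s)" "b \<in> G 0" "c \<in> G (sign_int (opp s))" "a \<oplus>\<^bsub>L\<^esub> b \<oplus>\<^bsub>L\<^esub> c \<in> I"
  shows "a \<in> U s \<and> b \<in> I0 \<and> c \<in> U (opp s)"
proof -
  obtain a' b' c' where *: "a' \<in> U s" "b' \<in> I0" "c' \<in> U (opp s)"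
    "a \<oplus>\<^bsub>L\<^esub> b \<oplus>\<^bsub>L\<^esub> c = a' \<oplus>\<^bsub>L\<^esub> b' \<oplus>\<^bsub>L\<^esub> c'"
    using assms(4) unfolding I_iff[of _ s] by blast
  have "a = a' \<and> b = b' \<and> c = c'"
    using G_decompose_unique[OF assms(1-3) jp_ideal_G[OF *(1)] _ jp_ideal_G[OF *(3)] *(4)]
      *(2) I0_subset_G by blast
  then show ?thesis
    using * by simp
qed

lemma I_inter_G:
  assumes "a \<in> I" "a \<in> G (sign_int s)"
  shows "a \<in> U s"
  using I_components[of a s "\<zero>\<^bsub>L\<^esub>" "\<zero>\<^bsub>L\<^esub>"] assms zero_in_G G_carrier by simp

lemma bracket_U_in_I:
  assumes u: "u \<in> U s" and y: "y \<in> carrier L"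
  shows "\<lblot>u, y\<rblot>\<^bsub>L\<^esub> \<in> I"
proof -
  obtain a b c where abc: "a \<in> G (sign_int s)" "b \<in> G 0" "c \<in> G (sign_int (opp s))"
    "y = a \<oplus>\<^bsub>L\<^esub> b \<oplus>\<^bsub>L\<^esub> c"
    using G_decompose[OF y] .
  note car = abc(1-3)[THEN G_carrier] jp_ideal_carrier[OF u]
  have "\<lblot>u, y\<rblot>\<^bsub>L\<^esub> = \<lblot>u, b\<rblot>\<^bsub>L\<^esub> \<oplus>\<^bsub>L\<^esub> \<lblot>u, c\<rblot>\<^bsub>L\<^esub>"
    using abc car G_bracket_same_sign[OF jp_ideal_G[OF u] abc(1)] by (simp add: bracket_add_right)
  moreover have "\<lblot>u, b\<rblot>\<^bsub>L\<^esub> \<in> I" "\<lblot>u, c\<rblot>\<^bsub>L\<^esub> \<in> I"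
    using jp_ideal_G_0_invariant[OF u abc(2)] bracket_in_I0[OF u abc(3)] U_subset_I I0_subset_I
    by blast+
  ultimately show ?thesis
    using submoduleE(5)[OF I_submodule] by simp
qed

text \<open>The component of \<open>y\<close> of degree \<open>s\<close> gives a triple product with \<open>u\<close> in an outer place, and the
  component of the opposite degree one with \<open>u\<close> in the middle; for degree \<open>0\<close> the Leibniz rule
  applies.\<close>

lemma bracket_bracket_in_I:
  assumes u: "u \<in> U s" and v: "v \<in> G (sign_int (opp s))" and y: "y \<in> carrier L"
  shows "\<lblot>\<lblot>u, v\<rblot>\<^bsub>L\<^esub>, y\<rblot>\<^bsub>L\<^esub> \<in> I"
proof -
  obtain a b c where abc: "a \<in> G (sign_int s)" "b \<in> G 0" "c \<in> G (sign_int (opp s))"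
    "y = a \<oplus>\<^bsub>L\<^esub> b \<oplus>\<^bsub>L\<^esub> c"
    using G_decompose[OF y] .
  note car = abc(1-3)[THEN G_carrier] jp_ideal_carrier[OF u] G_carrier[OF v]
  note I_add = submoduleE(5)[OF I_submodule] and I_minus = submoduleE(3)[OF I_submodule]
  have "\<lblot>\<lblot>u, v\<rblot>\<^bsub>L\<^esub>, a\<rblot>\<^bsub>L\<^esub> \<in> I"
    using jp_ideal_triple_left[OF u v abc(1)] U_subset_I by blast
  moreover have "\<lblot>\<lblot>u, v\<rblot>\<^bsub>L\<^esub>, b\<rblot>\<^bsub>L\<^esub> \<in> I"
  proof -
    have "\<lblot>b, \<lblot>u, v\<rblot>\<^bsub>L\<^esub>\<rblot>\<^bsub>L\<^esub> = \<lblot>\<lblot>b, u\<rblot>\<^bsub>L\<^esub>, v\<rblot>\<^bsub>L\<^esub> \<oplus>\<^bsub>L\<^esub> \<lblot>u, \<lblot>b, v\<rblot>\<^bsub>L\<^esub>\<rblot>\<^bsub>L\<^esub>"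
      using car by (intro bracket_leibniz)
    also have "\<dots> \<in> I"
      using bracket_U_in_I[OF jp_ideal_G_0_invariant(1)[OF u abc(2)]] bracket_U_in_I[OF u] car
      by (intro I_add) auto
    finally show ?thesis
      using bracket_anticomm[of "\<lblot>u, v\<rblot>\<^bsub>L\<^esub>" b] car I_minus by simp
  qed
  moreover have "\<lblot>\<lblot>u, v\<rblot>\<^bsub>L\<^esub>, c\<rblot>\<^bsub>L\<^esub> \<in> I"
  proof -
    have "\<lblot>\<lblot>v, u\<rblot>\<^bsub>L\<^esub>, c\<rblot>\<^bsub>L\<^esub> \<in> I"
      using jp_ideal_triple_middle[of v "opp s" u c] u v abc(3) U_subset_I by auto
    then show ?thesis
      using bracket_anticomm[of u v] car I_minus by (simp add: bracket_minus_left)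
  qed
  ultimately show ?thesis
    using car I_add unfolding abc(4) by (simp add: bracket_add_right)
qed

lemma pair_ideal_to_lie_ideal: "lie_ideal R L I"
proof -
  have car: "I \<subseteq> carrier L"
    using submoduleE(1)[OF I_submodule] .
  define N where "N = {x \<in> carrier L. \<forall>y\<in>carrier L. \<lblot>x, y\<rblot>\<^bsub>L\<^esub> \<in> I}"
  have N: "submodule N R L"
    using I_submodule
    by (auto simp: N_def submodule_iff bracket_add_left bracket_smult_left)
  have "U s \<subseteq> N" for s
    using bracket_U_in_I jp_ideal_carrier by (auto simp: N_def)
  moreover have "I0 \<subseteq> N"
    using bracket_bracket_in_I jp_ideal_carrier G_carrier
    by (intro I0_minimal[OF N]) (auto simp: N_def)
  ultimately have "I \<subseteq> N"
    unfolding I_eq by (intro set_add_subset[OF N]) auto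
  then show ?thesis
    using I_submodule by (auto simp: N_def lie_ideal_def)
qed

lemma pair_ideal_to_lie_minimal:
  assumes K: "lie_ideal R L K" and UK: "\<And>s. U s \<subseteq> K"
  shows "I \<subseteq> K"
proof -
  have S: "submodule K R L"
    using K by (simp add: lie_ideal_def)
  have "I0 \<subseteq> K"
    using K UK G_carrier by (intro I0_minimal[OF S]) (auto simp: lie_ideal_def subset_iff)
  then show ?thesis
    unfolding I_eq using UK by (intro set_add_subset[OF S]) auto
qed

section \<open>The quotient by the tilde ideal is nondegenerate\<close>

context
  assumes two: "\<one> \<oplus> \<one> \<in> Units R" and nd: "jp_nondegenerate (jp_quotient V U)"
begin

lemma absolute_zero_divisor_in_U:
  assumes "z \<in> G (sign_int s)" "\<And>y. y \<in> G (sign_int (opp s)) \<Longrightarrow> \<lblot>z, \<lblot>z, y\<rblot>\<^bsub>L\<^esub>\<rblot>\<^bsub>L\<^esub> \<in> U s"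
  shows "z \<in> U s"
  using nd[unfolded jp_nondegenerate_quotient_V_iff[OF two U]] assms by blast

text \<open>Bracketing with \<open>y\<close> of the opposite degree moves \<open>a\<close> to degree \<open>0\<close>, where it is separated from
  the other components; so \<open>\<lblot>a, y\<rblot>\<^bsub>L\<^esub>\<close> lies in the graded ideal \<open>I\<close>, and hence so does \<open>(ad a)\<^sup>2 y\<close>.\<close>

lemma tilde_component_in_U:
  assumes a: "a \<in> G (sign_int s)" and b: "b \<in> G 0" and c: "c \<in> G (sign_int (opp s))"
    and J: "a \<oplus>\<^bsub>L\<^esub> b \<oplus>\<^bsub>L\<^esub> c \<in> lie_tilde L I"
  shows "a \<in> U s"
proof (rule absolute_zero_divisor_in_U[OF a])
  fix y assume y: "y \<in> G (sign_int (opp s))"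
  note car = a[THEN G_carrier] b[THEN G_carrier] c[THEN G_carrier] y[THEN G_carrier]
  have "\<lblot>a \<oplus>\<^bsub>L\<^esub> b \<oplus>\<^bsub>L\<^esub> c, y\<rblot>\<^bsub>L\<^esub> \<in> I"
    using J car by (simp add: lie_tilde_def)
  then have "\<zero>\<^bsub>L\<^esub> \<oplus>\<^bsub>L\<^esub> \<lblot>a, y\<rblot>\<^bsub>L\<^esub> \<oplus>\<^bsub>L\<^esub> \<lblot>b, y\<rblot>\<^bsub>L\<^esub> \<in> I"
    using car G_bracket_same_sign[OF c y] by (simp add: bracket_add_left)
  then have "\<lblot>a, y\<rblot>\<^bsub>L\<^esub> \<in> I0"
    using I_components[OF zero_in_G G_bracket_opp(1)[OF a y] G_bracket_0_sign(1)[OF b y]] by blast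
  then have "\<lblot>a, \<lblot>a, y\<rblot>\<^bsub>L\<^esub>\<rblot>\<^bsub>L\<^esub> \<in> I"
    using lie_ideal_left[OF pair_ideal_to_lie_ideal] I0_subset_I car by blast
  then show "\<lblot>a, \<lblot>a, y\<rblot>\<^bsub>L\<^esub>\<rblot>\<^bsub>L\<^esub> \<in> U s"
    using G_bracket_0_sign(2)[OF G_bracket_opp(1)[OF a y] a] by (intro I_inter_G)
qed

lemma lie_tilde_inter_G:
  assumes "a \<in> lie_tilde L I" "a \<in> G (sign_int s)"
  shows "a \<in> U s"
  using tilde_component_in_U[of a s "\<zero>\<^bsub>L\<^esub>" "\<zero>\<^bsub>L\<^esub>"] assms zero_in_G G_carrier by simp

text \<open>In \<open>\<lblot>z, \<lblot>z, y\<rblot>\<^bsub>L\<^esub>\<rblot>\<^bsub>L\<^esub>\<close>, with \<open>y\<close> of degree opposite to that of \<open>a\<close>, the only contribution in the degree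
  of \<open>a\<close> is \<open>(ad a)\<^sup>2 y\<close>.\<close>

lemma outer_component_of_zero_divisor:
  assumes a: "a \<in> G (sign_int s)" and b: "b \<in> G 0" and c: "c \<in> G (sign_int (opp s))"
    and z: "z = a \<oplus>\<^bsub>L\<^esub> b \<oplus>\<^bsub>L\<^esub> c"
    and J: "\<forall>w\<in>carrier L. \<lblot>z, \<lblot>z, w\<rblot>\<^bsub>L\<^esub>\<rblot>\<^bsub>L\<^esub> \<in> lie_tilde L I"
  shows "a \<in> U s"
proof (rule absolute_zero_divisor_in_U[OF a])
  fix y assume y: "y \<in> G (sign_int (opp s))"
  note car = a[THEN G_carrier] b[THEN G_carrier] c[THEN G_carrier] y[THEN G_carrier]
  let ?p = "\<lblot>a, y\<rblot>\<^bsub>L\<^esub>" and ?q = "\<lblot>b, y\<rblot>\<^bsub>L\<^esub>"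
  have p: "?p \<in> G 0" and q: "?q \<in> G (sign_int (opp s))"
    using G_bracket_opp(1)[OF a y] G_bracket_0_sign(1)[OF b y] .
  have zy: "\<lblot>z, y\<rblot>\<^bsub>L\<^esub> = ?p \<oplus>\<^bsub>L\<^esub> ?q"
    using car G_bracket_same_sign[OF c y] unfolding z by (simp add: bracket_add_left)
  have "\<lblot>z, \<lblot>z, y\<rblot>\<^bsub>L\<^esub>\<rblot>\<^bsub>L\<^esub> = \<lblot>a, ?p\<rblot>\<^bsub>L\<^esub> \<oplus>\<^bsub>L\<^esub> (\<lblot>a, ?q\<rblot>\<^bsub>L\<^esub> \<oplus>\<^bsub>L\<^esub> \<lblot>b, ?p\<rblot>\<^bsub>L\<^esub>) \<oplus>\<^bsub>L\<^esub> (\<lblot>b, ?q\<rblot>\<^bsub>L\<^esub> \<oplus>\<^bsub>L\<^esub> \<lblot>c, ?p\<rblot>\<^bsub>L\<^esub>)"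
    using car G_bracket_same_sign[OF c q] unfolding zy unfolding z
    by (simp add: bracket_add_left bracket_add_right M.a_ac)
  then have "\<lblot>a, ?p\<rblot>\<^bsub>L\<^esub> \<oplus>\<^bsub>L\<^esub> (\<lblot>a, ?q\<rblot>\<^bsub>L\<^esub> \<oplus>\<^bsub>L\<^esub> \<lblot>b, ?p\<rblot>\<^bsub>L\<^esub>) \<oplus>\<^bsub>L\<^esub> (\<lblot>b, ?q\<rblot>\<^bsub>L\<^esub> \<oplus>\<^bsub>L\<^esub> \<lblot>c, ?p\<rblot>\<^bsub>L\<^esub>) \<in> lie_tilde L I"
    using J car(4) by force
  moreover have "\<lblot>a, ?q\<rblot>\<^bsub>L\<^esub> \<oplus>\<^bsub>L\<^esub> \<lblot>b, ?p\<rblot>\<^bsub>L\<^esub> \<in> G 0"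
    using G_add G_bracket_opp(1)[OF a q] G_bracket[OF b p] by simp
  moreover have "\<lblot>b, ?q\<rblot>\<^bsub>L\<^esub> \<oplus>\<^bsub>L\<^esub> \<lblot>c, ?p\<rblot>\<^bsub>L\<^esub> \<in> G (sign_int (opp s))"
    using G_add G_bracket_0_sign(1)[OF b q] G_bracket_0_sign(2)[OF p c] by simp
  ultimately show "\<lblot>a, \<lblot>a, y\<rblot>\<^bsub>L\<^esub>\<rblot>\<^bsub>L\<^esub> \<in> U s"
    using G_bracket_0_sign(2)[OF p a] tilde_component_in_U by blast
qed

text \<open>Put \<open>d = \<lblot>z, x\<rblot>\<^bsub>L\<^esub>\<close>. By the Leibniz rule \<open>\<lblot>d, \<lblot>d, y\<rblot>\<^bsub>L\<^esub>\<rblot>\<^bsub>L\<^esub>\<close> is the difference of \<open>\<lblot>d, \<lblot>z, \<lblot>x, y\<rblot>\<^bsub>L\<^esub>\<rblot>\<^bsub>L\<^esub>\<rblot>\<^bsub>L\<^esub>\<close> and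
  \<open>\<lblot>d, \<lblot>x, \<lblot>z, y\<rblot>\<^bsub>L\<^esub>\<rblot>\<^bsub>L\<^esub>\<rblot>\<^bsub>L\<^esub>\<close>. The first is a bracket of two values of \<open>ad z\<close>. So is the inner bracket of the
  second once \<open>d\<close> is moved past \<open>x\<close>, with which it commutes by degree.\<close>

lemma zero_divisor_of_degree_0:
  assumes z: "z \<in> G 0" and J: "\<forall>w\<in>carrier L. \<lblot>z, \<lblot>z, w\<rblot>\<^bsub>L\<^esub>\<rblot>\<^bsub>L\<^esub> \<in> lie_tilde L I"
    and x: "x \<in> G (sign_int s)"
  shows "\<lblot>z, x\<rblot>\<^bsub>L\<^esub> \<in> U s"
proof (rule absolute_zero_divisor_in_U)
  let ?J = "lie_tilde L I" and ?a = "\<lblot>z, x\<rblot>\<^bsub>L\<^esub>"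
  have idJ: "lie_ideal R L ?J"
    by (rule lie_ideal_tilde[OF pair_ideal_to_lie_ideal])
  then have SJ: "submodule ?J R L"
    by (simp add: lie_ideal_def)
  show a: "?a \<in> G (sign_int s)"
    by (rule G_bracket_0_sign(1)[OF z x])
  fix y assume y: "y \<in> G (sign_int (opp s))"
  note car = z[THEN G_carrier] x[THEN G_carrier] y[THEN G_carrier]
  note comm = absolute_zero_divisor_brackets_commute[OF two idJ car(1) J]
  have "\<lblot>x, \<lblot>?a, \<lblot>z, y\<rblot>\<^bsub>L\<^esub>\<rblot>\<^bsub>L\<^esub>\<rblot>\<^bsub>L\<^esub> \<in> ?J"
    using lie_ideal_left[OF idJ] comm car by simp
  moreover have "\<lblot>?a, \<lblot>x, \<lblot>z, y\<rblot>\<^bsub>L\<^esub>\<rblot>\<^bsub>L\<^esub>\<rblot>\<^bsub>L\<^esub> = \<lblot>x, \<lblot>?a, \<lblot>z, y\<rblot>\<^bsub>L\<^esub>\<rblot>\<^bsub>L\<^esub>\<rblot>\<^bsub>L\<^esub>"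
    using bracket_leibniz[of ?a x "\<lblot>z, y\<rblot>\<^bsub>L\<^esub>"] G_bracket_same_sign[OF a x] car by simp
  moreover have "\<lblot>?a, \<lblot>z, \<lblot>x, y\<rblot>\<^bsub>L\<^esub>\<rblot>\<^bsub>L\<^esub>\<rblot>\<^bsub>L\<^esub> = \<lblot>?a, \<lblot>?a, y\<rblot>\<^bsub>L\<^esub>\<rblot>\<^bsub>L\<^esub> \<oplus>\<^bsub>L\<^esub> \<lblot>?a, \<lblot>x, \<lblot>z, y\<rblot>\<^bsub>L\<^esub>\<rblot>\<^bsub>L\<^esub>\<rblot>\<^bsub>L\<^esub>"
    using bracket_leibniz[of z x y] car by (simp add: bracket_add_right)
  moreover have "\<lblot>?a, \<lblot>z, \<lblot>x, y\<rblot>\<^bsub>L\<^esub>\<rblot>\<^bsub>L\<^esub>\<rblot>\<^bsub>L\<^esub> \<in> ?J"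
    using comm car by simp
  ultimately have "\<lblot>?a, \<lblot>?a, y\<rblot>\<^bsub>L\<^esub>\<rblot>\<^bsub>L\<^esub> \<in> ?J"
    using submodule_cancel[OF SJ] car by simp
  moreover have "\<lblot>?a, \<lblot>?a, y\<rblot>\<^bsub>L\<^esub>\<rblot>\<^bsub>L\<^esub> \<in> G (sign_int s)"
    using G_bracket_0_sign(2)[OF G_bracket_opp(1)[OF a y] a] .
  ultimately show "\<lblot>?a, \<lblot>?a, y\<rblot>\<^bsub>L\<^esub>\<rblot>\<^bsub>L\<^esub> \<in> U s"
    by (rule lie_tilde_inter_G)
qed

text \<open>Once the outer components \<open>a\<close> and \<open>c\<close> of an absolute zero divisor are known to lie in the ideal,
  the middle component \<open>b\<close> is itself an absolute zero divisor. It then maps both extreme degrees into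
  \<open>U\<close>, and since these generate \<open>L\<close>, it is central modulo \<open>I\<close>.\<close>

lemma lie_tilde_quotient_nondegenerate: "lie_nondegenerate (lie_quotient L (lie_tilde L I))"
proof -
  let ?J = "lie_tilde L I"
  note idI = pair_ideal_to_lie_ideal
  note idJ = lie_ideal_tilde(1)[OF idI] and IJ = lie_ideal_tilde(2)[OF idI]
  have SJ: "submodule ?J R L"
    using idJ by (simp add: lie_ideal_def)
  have "z \<in> ?J" if z: "z \<in> carrier L" and J: "\<forall>w\<in>carrier L. \<lblot>z, \<lblot>z, w\<rblot>\<^bsub>L\<^esub>\<rblot>\<^bsub>L\<^esub> \<in> ?J" for z
  proof -
    obtain a b c where abc: "a \<in> G (sign_int Pos)" "b \<in> G 0" "c \<in> G (sign_int (opp Pos))"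
      "z = a \<oplus>\<^bsub>L\<^esub> b \<oplus>\<^bsub>L\<^esub> c"
      using G_decompose[OF z] .
    note car = abc(1-3)[THEN G_carrier]
    have "z = c \<oplus>\<^bsub>L\<^esub> b \<oplus>\<^bsub>L\<^esub> a"
      using abc(4) car by (simp add: M.a_ac)
    then have "a \<in> U Pos" "c \<in> U (opp Pos)"
      using outer_component_of_zero_divisor[OF abc J]
        outer_component_of_zero_divisor[of c "opp Pos" b a z] abc J by auto
    then have ac: "a \<in> ?J" "c \<in> ?J"
      using U_subset_I IJ by auto
    have b_cong: "\<lblot>b, \<lblot>b, w\<rblot>\<^bsub>L\<^esub>\<rblot>\<^bsub>L\<^esub> \<in> ?J" if w: "w \<in> carrier L" for w
    proof -
      let ?e = "a \<oplus>\<^bsub>L\<^esub> c"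
      have e: "?e \<in> ?J" "?e \<in> carrier L"
        using ac submoduleE(5)[OF SJ] car by auto
      have z': "z = b \<oplus>\<^bsub>L\<^esub> ?e"
        using abc(4) car by (simp add: M.a_ac)
      have "\<lblot>z, \<lblot>z, w\<rblot>\<^bsub>L\<^esub>\<rblot>\<^bsub>L\<^esub> = \<lblot>b, \<lblot>b, w\<rblot>\<^bsub>L\<^esub>\<rblot>\<^bsub>L\<^esub> \<oplus>\<^bsub>L\<^esub> (\<lblot>b, \<lblot>?e, w\<rblot>\<^bsub>L\<^esub>\<rblot>\<^bsub>L\<^esub> \<oplus>\<^bsub>L\<^esub> \<lblot>?e, \<lblot>z, w\<rblot>\<^bsub>L\<^esub>\<rblot>\<^bsub>L\<^esub>)"
        using e(2) w car z' by (simp add: bracket_add_left bracket_add_right M.a_ac)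
      moreover have "\<lblot>b, \<lblot>?e, w\<rblot>\<^bsub>L\<^esub>\<rblot>\<^bsub>L\<^esub> \<oplus>\<^bsub>L\<^esub> \<lblot>?e, \<lblot>z, w\<rblot>\<^bsub>L\<^esub>\<rblot>\<^bsub>L\<^esub> \<in> ?J"
        using e w z car idJ lie_ideal_left[OF idJ]
        by (intro submoduleE(5)[OF SJ]) (auto simp: lie_ideal_def)
      ultimately show ?thesis
        using submodule_cancel[OF SJ] J w car by (metis bracket_closed)
    qed
    have bU: "\<lblot>b, x\<rblot>\<^bsub>L\<^esub> \<in> U s" if "x \<in> G (sign_int s)" for s x
      using zero_divisor_of_degree_0[OF abc(2) _ that] b_cong by blast
    \<comment> \<open>The preimage of \<open>I\<close> under \<open>ad b\<close> is closed under brackets of the extreme degrees, as \<open>ad b\<close>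
      is a derivation; so it is all of \<open>L\<close>.\<close>
    define N where "N = {w \<in> carrier L. \<lblot>b, w\<rblot>\<^bsub>L\<^esub> \<in> I}"
    have N: "submodule N R L"
      using I_submodule car(2)
      by (auto simp: N_def submodule_iff bracket_add_right bracket_smult_right)
    have GN: "G (sign_int s) \<subseteq> N" for s
      using bU U_subset_I G_carrier by (auto simp: N_def)
    have G0N: "G 0 \<subseteq> N"
      unfolding G_0_span[of Pos]
    proof (rule bracket_span_minimal[OF N])
      fix x y assume xy: "x \<in> G (sign_int Pos)" "y \<in> G (sign_int (opp Pos))"
      then have "\<lblot>b, x\<rblot>\<^bsub>L\<^esub> \<in> I" "\<lblot>b, y\<rblot>\<^bsub>L\<^esub> \<in> I" "x \<in> carrier L" "y \<in> carrier L"
        using subsetD[OF GN[of Pos]] subsetD[OF GN[of "opp Pos"]] by (auto simp: N_def)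
      then show "\<lblot>x, y\<rblot>\<^bsub>L\<^esub> \<in> N"
        using bracket_leibniz[of b x y] car(2) lie_ideal_left[OF idI] idI
          submoduleE(5)[OF I_submodule]
        by (simp add: N_def lie_ideal_def)
    qed
    have "w \<in> N" if w: "w \<in> carrier L" for w
    proof -
      obtain p q r where "p \<in> G (sign_int Pos)" "q \<in> G 0" "r \<in> G (sign_int (opp Pos))"
        "w = p \<oplus>\<^bsub>L\<^esub> q \<oplus>\<^bsub>L\<^esub> r"
        using G_decompose[OF w] .
      then show ?thesis
        using GN G0N submoduleE(5)[OF N] by blast
    qed
    then have "b \<in> ?J"
      using car(2) by (simp add: lie_tilde_def N_def)
    then show ?thesis
      unfolding abc(4) using ac submoduleE(5)[OF SJ] by blast
  qed
  then show ?thesis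
    unfolding lie_nondegenerate_quotient_iff[OF idJ] by blast
qed

end

end

section \<open>Traces of nondegenerate ideals on the pair\<close>

lemma trace_jp_ideal:
  assumes two: "\<one> \<oplus> \<one> \<in> Units R" and K: "lie_ideal R L K"
  shows "jp_ideal R V (\<lambda>s. K \<inter> G (sign_int s))"
proof -
  have S: "submodule K R L"
    using K by (simp add: lie_ideal_def)
  have KR: "\<lblot>u, y\<rblot>\<^bsub>L\<^esub> \<in> K" if "u \<in> K" "y \<in> carrier L" for u y
    using K that by (simp add: lie_ideal_def)
  have KL: "\<lblot>y, u\<rblot>\<^bsub>L\<^esub> \<in> K" if "u \<in> K" "y \<in> carrier L" for u y
    using lie_ideal_left[OF K] that by simp
  have sub: "submodule (K \<inter> G (sign_int s)) R L" for s
    using S G_submodule unfolding submodule_iff by blast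
  have deg: "jpQ V s x y \<in> G (sign_int s)"
    if "x \<in> G (sign_int s)" "y \<in> G (sign_int (opp s))" for s x y
    using jordan_pair.jpQ_closed[OF jordan_pair, of x s y] that by simp
  have trip: "jp_triple V s x y u \<in> K \<inter> G (sign_int s)"
    if xy: "x \<in> G (sign_int s)" "y \<in> G (sign_int (opp s))" and u: "u \<in> K" "u \<in> G (sign_int s)"
    for s x y u
    unfolding triple_product[OF xy u(2)]
    using KL[OF u(1)] G_carrier[OF G_bracket_opp(1)[OF xy]]
      G_bracket_0_sign(1)[OF G_bracket_opp(1)[OF xy] u(2)] by blast
  show ?thesis
    unfolding jp_ideal_def submodule_V_iff V_simps
  proof (intro allI conjI ballI sub)
    show "jpQ V s u y \<in> K \<inter> G (sign_int s)"
      if "u \<in> K \<inter> G (sign_int s)" "y \<in> G (sign_int (opp s))" for s u y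
      using that deg KR G_carrier by (auto simp: jpQ_mem_iff[OF two S])
    show "jpQ V s x u \<in> K \<inter> G (sign_int s)"
      if "x \<in> G (sign_int s)" "u \<in> K \<inter> G (sign_int (opp s))" for s x u
      using that deg KL G_carrier by (auto simp: jpQ_mem_iff[OF two S])
  qed (use trip in auto)
qed

text \<open>For \<open>z\<close> of extreme degree, \<open>(ad z)\<^sup>2\<close> kills the components of its own degree and of degree \<open>0\<close>.\<close>

lemma trace_nondegenerate:
  assumes two: "\<one> \<oplus> \<one> \<in> Units R" and K: "lie_ideal R L K"
    and nd: "lie_nondegenerate (lie_quotient L K)"
  shows "jp_nondegenerate (jp_quotient V (\<lambda>s. K \<inter> G (sign_int s)))"
  unfolding jp_nondegenerate_quotient_V_iff[OF two trace_jp_ideal[OF two K]]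
proof (intro allI ballI impI)
  fix s z
  assume z: "z \<in> G (sign_int s)"
    and zy: "\<forall>y\<in>G (sign_int (opp s)). \<lblot>z, \<lblot>z, y\<rblot>\<^bsub>L\<^esub>\<rblot>\<^bsub>L\<^esub> \<in> K \<inter> G (sign_int s)"
  have S: "submodule K R L"
    using K by (simp add: lie_ideal_def)
  have "\<lblot>z, \<lblot>z, w\<rblot>\<^bsub>L\<^esub>\<rblot>\<^bsub>L\<^esub> \<in> K" if w: "w \<in> carrier L" for w
  proof -
    obtain a b c where abc: "a \<in> G (sign_int s)" "b \<in> G 0" "c \<in> G (sign_int (opp s))"
      "w = a \<oplus>\<^bsub>L\<^esub> b \<oplus>\<^bsub>L\<^esub> c"
      using G_decompose[OF w] .
    note car = abc(1-3)[THEN G_carrier] G_carrier[OF z]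
    have "\<lblot>z, \<lblot>z, w\<rblot>\<^bsub>L\<^esub>\<rblot>\<^bsub>L\<^esub> = \<lblot>z, \<lblot>z, c\<rblot>\<^bsub>L\<^esub>\<rblot>\<^bsub>L\<^esub>"
      unfolding abc(4)
      using car G_bracket_same_sign[OF z abc(1)]
        G_bracket_same_sign[OF z G_bracket_0_sign(2)[OF abc(2) z]]
      by (simp add: bracket_add_right)
    then show ?thesis
      using zy abc(3) by simp
  qed
  then show "z \<in> K \<inter> G (sign_int s)"
    using nd[unfolded lie_nondegenerate_quotient_iff[OF K]] z G_carrier by blast
qed

end

section \<open>The Kostrikin radical\<close>

lemma two_unit:
  assumes "field R" and char: "ring_char R = 0 \<or> ring_char R \<ge> 5"
  shows "\<one>\<^bsub>R\<^esub> \<oplus>\<^bsub>R\<^esub> \<one>\<^bsub>R\<^esub> \<in> Units R"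
proof -
  interpret field R by fact
  have "\<one>\<^bsub>R\<^esub> \<oplus>\<^bsub>R\<^esub> \<one>\<^bsub>R\<^esub> \<noteq> \<zero>\<^bsub>R\<^esub>"
  proof
    assume eq: "\<one>\<^bsub>R\<^esub> \<oplus>\<^bsub>R\<^esub> \<one>\<^bsub>R\<^esub> = \<zero>\<^bsub>R\<^esub>"
    let ?P = "\<lambda>n::nat. n > 0 \<and> [n] \<cdot>\<^bsub>R\<^esub> \<one>\<^bsub>R\<^esub> = \<zero>\<^bsub>R\<^esub>"
    have P: "?P 2"
      using eq by (simp add: numeral_2_eq_2)
    then have "ring_char R = (LEAST n. ?P n)"
      unfolding ring_char_def by (intro if_P) blast
    moreover have "(LEAST n. ?P n) \<le> 2" "?P (LEAST n. ?P n)"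
      using P by (rule Least_le, rule LeastI)
    ultimately show False
      using char by auto
  qed
  then show ?thesis
    by (simp add: field_Units)
qed

theorem proposition7p3:
  fixes \<Phi> :: "('k, 'r) ring_scheme"
    and L :: "('k, 'a, 'l) lie_alg_scheme"
    and G :: "int \<Rightarrow> 'a set"
  assumes "field \<Phi>"
    and "ring_char \<Phi> = 0 \<or> ring_char \<Phi> \<ge> 5"
    and "jordan_3graded_lie_algebra \<Phi> L G"
  shows "kostrikin_radical \<Phi> L =
    lie_tilde L (pair_ideal_to_lie \<Phi> L G
      (mccrimmon_radical \<Phi> (associated_jpair \<Phi> L G)))"
proof -
  interpret jordan_3graded_lie_algebra \<Phi> L G by fact
  interpret P: jordan_pair \<Phi> V by (rule jordan_pair)
  note two = two_unit[OF assms(1,2)]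
  let ?K = "kostrikin_radical \<Phi> L" and ?M = "mccrimmon_radical \<Phi> V"
  let ?I = "pair_ideal_to_lie \<Phi> L G ?M"
  note M = P.mccrimmon_radical_ideal P.mccrimmon_radical_nondegenerate
  note K = kostrikin_radical_ideal kostrikin_radical_nondegenerate
  show ?thesis
  proof
    show "?K \<subseteq> lie_tilde L ?I"
      using lie_ideal_tilde(1)[OF pair_ideal_to_lie_ideal[OF M(1)]]
        lie_tilde_quotient_nondegenerate[OF M(1) two M(2)]
      by (rule kostrikin_radical_least)
    have "?M s \<subseteq> ?K \<inter> G (sign_int s)" for s
      using trace_jp_ideal[OF two K(1)] trace_nondegenerate[OF two K]
      by (rule P.mccrimmon_radical_least)
    then have "?I \<subseteq> ?K"
      using pair_ideal_to_lie_minimal[OF M(1) K(1)] by blast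
    then have "lie_tilde L ?I \<subseteq> lie_tilde L ?K"
      by (auto simp: lie_tilde_def)
    also have "\<dots> \<subseteq> ?K"
      using K by (rule lie_tilde_subset_if_nondegenerate)
    finally show "lie_tilde L ?I \<subseteq> ?K" .
  qed
qed

end
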